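(* Let $h,G,R,\rho,C,L,\tau,u^0,(u^k)_{k\ge 0}$ be as described in the context, so that the basic assumptions, Assumptions A and Assumptions B all hold; put $z^k:=\rho(u^k)$ and let $z^*$ be the limit of the sequence $z^k$. Then all accumulation points $u^*\in\operatorname{accum}(u^0)$ of $(u^k)_{k=1}^\infty$ are stationary points of $E$, i.e. $u^*\in\operatorname{crit}E$, and belong to the same outer sequence $z^k$, so that $z^*=\rho(u^* )$.
   Context: Notation. $\overline{\mathbb R}=\mathbb R\cup\{+\infty\}$; for $f:\mathbb R^d\to\overline{\mathbb R}$, $\operatorname{dom}f=\{x: f(x)<\infty\}$; $f$ is proper if $\operatorname{dom}f\ne\emptyset$; $f$ is lower semi-continuous if $\liminf_{x\to\bar x}f(x)\ge f(\bar x)$ for all $\bar x\in\operatorname{dom}f$. $\operatorname{dist}(u,S)=\inf_{x\in S}\|u-x\|$. A proper convex function $h$ is essentially smooth if its convex subdifferential $\partial h$ is locally bounded and single-valued on its domain, or equivalently if $\operatorname{dom}\partial h=\operatorname{int}\operatorname{dom}h\neq\emptyset$. Basic assumptions. $C\subset\mathbb R^m$ is closed and convex with $\operatorname{int}C\ne\emptyset$. $h:\mathbb R^m\to\overline{\mathbb R}$ is proper, lower semi-continuous, convex, essentially smooth, with $\overline{\operatorname{dom}h}=C$. $G:\mathbb R^m\to\overline{\mathbb R}$ is proper, lower semi-continuous, $\operatorname{dom}h\subset\operatorname{dom}G$, and $G$ is differentiable on $\operatorname{int}\operatorname{dom}h$. $R:\mathbb R^n\to\overline{\mathbb R}$ is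 proper, lower semi-continuous and $\operatorname{dom}R\cap\rho^{-1}(\operatorname{int}\operatorname{dom}h)\neq\emptyset$. $\rho:\mathbb R^n\to\mathbb R^m$ is continuous. The objective is $E(u)=G(\rho(u))+R(u)$, to be minimized over $\Delta=\rho^{-1}(C)$. Bregman distance: $D_h(x,y)=h(x)-h(y)-\langle\nabla h(y),x-y\rangle$ for $x\in\mathbb R^m$, $y\in\operatorname{int}\operatorname{dom}h$ (and $D_h(x,y)=\infty$ if $y\notin\operatorname{int}\operatorname{dom}h$). For a step size $\tau>0$ and a point $u^k$ with $\rho(u^k)\in\operatorname{int}\operatorname{dom}h$, $$E_{u^k}(u)=\tfrac1\tau D_h(\rho(u),\rho(u^k))+G(\rho(u^k))+\langle\nabla G(\rho(u^k)),\rho(u)-\rho(u^k)\rangle+R(u).$$ The algorithm starts from a vector $u^0\in\rho^{-1}(\operatorname{int}\operatorname{dom}h)$ and obtains $u^{k+1}$ from the subproblem of minimizing $E_{u^k}$, the required accuracy of the solution being only what is specified in Assumptions A and B. Assumptions A. The basic assumptions hold; $E$ is bounded from below; $E$ is coercive; $L>0$ and $Lh-G$ is convex on $\operatorname{int}\operatorname{dom}h$; every iteration is solved sufficiently, so that $E_{u^k}(u^{k+1})\le E_{u^k}(u^k)=E(u^k)$ and $u^{k+1}\in\rho^{-1}(\operatorname{int}\operatorname{dom}h)$. Subdifferentials. For $f:\mathbb R^n\to\overline{\mathbb R}$ and $\bar u\in\operatorname{dom}f$, $v\in\hat\partial f(\bar u)$ iff $\liminf_{u\to\bar u,u\ne\bar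 u}\frac{f(u)-f(\bar u)-\langle v,u-\bar u\rangle}{\|u-\bar u\|}\ge0$; $v\in\partial f(\bar u)$ (limiting subgradient) iff there are $u^i\to\bar u$ with $f(u^i)\to f(\bar u)$ and $v^i\in\hat\partial f(u^i)$ with $v^i\to v$. Kurdyka-Łojasiewicz (KŁ) property of $E$ at $\bar u\in\operatorname{dom}E$: there exist $\eta>0$, $\varphi\in C^0[0,\eta)\cap C^1(0,\eta)$ with $\varphi(0)=0$, $\varphi$ concave, $\varphi'>0$, and a neighborhood $U$ of $\bar u$ such that $\varphi'(E(u)-E(\bar u))\operatorname{dist}(0,\partial E(u))\ge1$ for all $u\in U$ with $E(\bar u)<E(u)<E(\bar u)+\eta$. $\operatorname{accum}(u^0)$ is the set of all limits of convergent subsequences of $(u^k)$. With $J_\rho$ the Jacobian of $\rho$, $\operatorname{crit}E$ is the set of all $\bar u\in\rho^{-1}(\operatorname{int}\operatorname{dom}h)$ with $-J_\rho(\bar u)^*\nabla G(\rho(\bar u))\in\partial R(\bar u)$. Assumptions B. $E$ is continuous on its domain and satisfies the KŁ property at every point of $\operatorname{accum}(u^0)$; $h$ is strongly convex on $\operatorname{int}\operatorname{dom}h$ (with some modulus $>0$); $\rho$ is continuously differentiable; $\frac1\tau\nabla h-\nabla G$ is locally Lipschitz continuous on $\operatorname{int}\operatorname{dom}h$; with $Z=(z^k)_{k=1}^\infty$, the closure $\overline Z$ is contained in $\operatorname{int}\operatorname{dom}h$; every iteration satisfies $0\in\partial E_{u^k}(u^{k+1})$ and uses a step size $\tau<\frac1L$.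 About $z^*$: under these assumptions it is known that the sequence $z^k$ either has finite length and converges to a limit $z^*\in\operatorname{int}\operatorname{dom}h$, or can be terminated after a finite number of steps. *)

theory Defs
  imports "HOL-Analysis.Analysis"
begin

text \<open>
  A function into the reals extended by \<open>+\<infinity>\<close> is an \<^typ>\<open>ereal\<close>-valued function that never takes
  the value \<open>-\<infinity>\<close>; this codomain restriction is the first conjunct of \<open>proper_fun\<close>.
\<close>

definition edom :: "('a \<Rightarrow> ereal) \<Rightarrow> 'a set" where
  "edom f = {x. f x < \<infinity>}"

definition proper_fun :: "('a \<Rightarrow> ereal) \<Rightarrow> bool" where
  "proper_fun f \<longleftrightarrow> (\<forall>x. f x \<noteq> -\<infinity>) \<and> edom f \<noteq> {}"

text \<open>Lower semi-continuity is only required at the points of the effective domain.\<close>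

definition lsc_fun :: "('a::topological_space \<Rightarrow> ereal) \<Rightarrow> bool" where
  "lsc_fun f \<longleftrightarrow> (\<forall>x \<in> edom f. f x \<le> Liminf (at x) f)"

definition convex_fun :: "('a::real_vector \<Rightarrow> ereal) \<Rightarrow> bool" where
  "convex_fun f \<longleftrightarrow> (\<forall>x y. \<forall>t \<in> {0<..<1::real}.
     f ((1 - t) *\<^sub>R x + t *\<^sub>R y) \<le> ereal (1 - t) * f x + ereal t * f y)"

definition strongly_convex_on :: "real \<Rightarrow> 'a::real_normed_vector set \<Rightarrow> ('a \<Rightarrow> real) \<Rightarrow> bool" where
  "strongly_convex_on \<sigma> S f \<longleftrightarrow> convex S \<and> (\<forall>x \<in> S. \<forall>y \<in> S. \<forall>t \<in> {0..1::real}.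
     f ((1 - t) *\<^sub>R x + t *\<^sub>R y)
       \<le> (1 - t) * f x + t * f y - \<sigma> / 2 * t * (1 - t) * (norm (x - y))\<^sup>2)"

text \<open>Gradient of the real part; unspecified where that real part is not differentiable.\<close>

definition egrad :: "('a::real_inner \<Rightarrow> ereal) \<Rightarrow> 'a \<Rightarrow> 'a" where
  "egrad f x = (THE g. GDERIV (\<lambda>y. real_of_ereal (f y)) x :> g)"

text \<open>
  The library's \<^const>\<open>infdist\<close> and \<^const>\<open>setdist\<close> are \<open>0\<close> for the empty set; here the distance
  to the empty set is \<open>\<infinity>\<close>.
\<close>

definition edist_set :: "'a::real_normed_vector \<Rightarrow> 'a set \<Rightarrow> ereal" where
  "edist_set u S = (INF x\<in>S. ereal (norm (u - x)))"

definition convex_subdiff :: "('a::real_inner \<Rightarrow> ereal) \<Rightarrow> 'a \<Rightarrow> 'a set" where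
  "convex_subdiff f x = {v. x \<in> edom f \<and> (\<forall>y. f x + ereal (v \<bullet> (y - x)) \<le> f y)}"

definition essentially_smooth :: "('a::real_inner \<Rightarrow> ereal) \<Rightarrow> bool" where
  "essentially_smooth f \<longleftrightarrow> (\<forall>x. convex_subdiff f x \<noteq> {} \<longrightarrow>
     (\<exists>!v. v \<in> convex_subdiff f x) \<and>
     (\<exists>U. open U \<and> x \<in> U \<and> bounded (\<Union>y\<in>U. convex_subdiff f y)))"

definition frechet_subdiff :: "('a::real_inner \<Rightarrow> ereal) \<Rightarrow> 'a \<Rightarrow> 'a set" where
  "frechet_subdiff f x = {v. x \<in> edom f \<and>
     0 \<le> Liminf (at x) (\<lambda>y. (f y - f x - ereal (v \<bullet> (y - x))) / ereal (norm (y - x)))}"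

definition limiting_subdiff :: "('a::real_inner \<Rightarrow> ereal) \<Rightarrow> 'a \<Rightarrow> 'a set" where
  "limiting_subdiff f x = {v. x \<in> edom f \<and>
     (\<exists>xs vs. xs \<longlonglongrightarrow> x \<and> (\<lambda>i. f (xs i)) \<longlonglongrightarrow> f x \<and>
        (\<forall>i. vs i \<in> frechet_subdiff f (xs i)) \<and> vs \<longlonglongrightarrow> v)}"

definition KL_at :: "('a::real_inner \<Rightarrow> ereal) \<Rightarrow> 'a \<Rightarrow> bool" where
  "KL_at f x \<longleftrightarrow> x \<in> edom f \<and>
     (\<exists>\<eta> \<phi> \<phi>' U. 0 < \<eta> \<and>
        continuous_on {0..<\<eta>} \<phi> \<and>
        (\<forall>s \<in> {0<..<\<eta>}. (\<phi> has_real_derivative \<phi>' s) (at s)) \<and>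
        continuous_on {0<..<\<eta>} \<phi>' \<and>
        \<phi> 0 = 0 \<and> concave_on {0..<\<eta>} \<phi> \<and> (\<forall>s \<in> {0<..<\<eta>}. 0 < \<phi>' s) \<and>
        open U \<and> x \<in> U \<and>
        (\<forall>u \<in> U. f x < f u \<and> f u < f x + ereal \<eta> \<longrightarrow>
           1 \<le> ereal (\<phi>' (real_of_ereal (f u - f x))) * edist_set 0 (limiting_subdiff f u)))"

definition bregman :: "('a::real_inner \<Rightarrow> ereal) \<Rightarrow> 'a \<Rightarrow> 'a \<Rightarrow> ereal" where
  "bregman h x y =
     (if y \<in> interior (edom h) then h x - h y - ereal (egrad h y \<bullet> (x - y)) else \<infinity>)"

definition objective ::
  "('b \<Rightarrow> ereal) \<Rightarrow> ('a \<Rightarrow> ereal) \<Rightarrow> ('a \<Rightarrow> 'b) \<Rightarrow> 'a \<Rightarrow> ereal" where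
  "objective G R \<rho> u = G (\<rho> u) + R u"

definition surrogate ::
  "('b::real_inner \<Rightarrow> ereal) \<Rightarrow> ('b \<Rightarrow> ereal) \<Rightarrow> ('a \<Rightarrow> ereal) \<Rightarrow> ('a \<Rightarrow> 'b) \<Rightarrow> real
     \<Rightarrow> 'a \<Rightarrow> 'a \<Rightarrow> ereal" where
  "surrogate h G R \<rho> \<tau> w u =
     ereal (1 / \<tau>) * bregman h (\<rho> u) (\<rho> w) + G (\<rho> w)
       + ereal (egrad G (\<rho> w) \<bullet> (\<rho> u - \<rho> w)) + R u"

definition accum :: "(nat \<Rightarrow> 'a::topological_space) \<Rightarrow> 'a set" where
  "accum u = {l. \<exists>r. strict_mono (r :: nat \<Rightarrow> nat) \<and> (u \<circ> r) \<longlonglongrightarrow> l}"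

definition crit ::
  "(real^'m \<Rightarrow> ereal) \<Rightarrow> (real^'m \<Rightarrow> ereal) \<Rightarrow> (real^'n \<Rightarrow> ereal) \<Rightarrow> (real^'n \<Rightarrow> real^'m)
     \<Rightarrow> (real^'n) set" where
  "crit h G R \<rho> = {u. \<rho> u \<in> interior (edom h) \<and>
     - (transpose (jacobian \<rho> (at u)) *v egrad G (\<rho> u)) \<in> limiting_subdiff R u}"

definition basic_assumptions ::
  "(real^'m) set \<Rightarrow> (real^'m \<Rightarrow> ereal) \<Rightarrow> (real^'m \<Rightarrow> ereal) \<Rightarrow> (real^'n \<Rightarrow> ereal)
     \<Rightarrow> (real^'n \<Rightarrow> real^'m) \<Rightarrow> bool" where
  "basic_assumptions C h G R \<rho> \<longleftrightarrow>
     closed C \<and> convex C \<and> interior C \<noteq> {} \<and>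
     proper_fun h \<and> lsc_fun h \<and> convex_fun h \<and> essentially_smooth h \<and> closure (edom h) = C \<and>
     proper_fun G \<and> lsc_fun G \<and> edom h \<subseteq> edom G \<and>
     (\<lambda>x. real_of_ereal (G x)) differentiable_on interior (edom h) \<and>
     proper_fun R \<and> lsc_fun R \<and> edom R \<inter> \<rho> -` interior (edom h) \<noteq> {} \<and>
     continuous_on UNIV \<rho>"

text \<open>
  The descent condition reads \<open>E\<^sub>k(u\<^sub>k\<^sub>+\<^sub>1) \<le> E\<^sub>k(u\<^sub>k)\<close>; the value \<open>E\<^sub>k(u\<^sub>k)\<close> of the surrogate at its
  base point is the objective \<open>E(u\<^sub>k)\<close>, since the Bregman distance vanishes there.
\<close>

definition assumptions_A ::
  "(real^'m) set \<Rightarrow> (real^'m \<Rightarrow> ereal) \<Rightarrow> (real^'m \<Rightarrow> ereal) \<Rightarrow> (real^'n \<Rightarrow> ereal)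
     \<Rightarrow> (real^'n \<Rightarrow> real^'m) \<Rightarrow> real \<Rightarrow> real \<Rightarrow> (nat \<Rightarrow> real^'n) \<Rightarrow> bool" where
  "assumptions_A C h G R \<rho> L \<tau> u \<longleftrightarrow>
     basic_assumptions C h G R \<rho> \<and>
     (\<exists>b::real. \<forall>v. ereal b \<le> objective G R \<rho> v) \<and>
     (objective G R \<rho> \<longlongrightarrow> \<infinity>) at_infinity \<and>
     0 < L \<and>
     convex_on (interior (edom h)) (\<lambda>x. L * real_of_ereal (h x) - real_of_ereal (G x)) \<and>
     0 < \<tau> \<and>
     u 0 \<in> \<rho> -` interior (edom h) \<and>
     (\<forall>k. surrogate h G R \<rho> \<tau> (u k) (u (Suc k)) \<le> surrogate h G R \<rho> \<tau> (u k) (u k) \<and>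
          u (Suc k) \<in> \<rho> -` interior (edom h))"

text \<open>
  \<^const>\<open>local_lipschitz\<close> is about families of functions indexed by a time parameter; the family
  used below is constant in it.
\<close>

definition assumptions_B ::
  "(real^'m \<Rightarrow> ereal) \<Rightarrow> (real^'m \<Rightarrow> ereal) \<Rightarrow> (real^'n \<Rightarrow> ereal)
     \<Rightarrow> (real^'n \<Rightarrow> real^'m) \<Rightarrow> real \<Rightarrow> real \<Rightarrow> (nat \<Rightarrow> real^'n) \<Rightarrow> bool" where
  "assumptions_B h G R \<rho> L \<tau> u \<longleftrightarrow>
     continuous_on (edom (objective G R \<rho>)) (objective G R \<rho>) \<and>
     (\<forall>v \<in> accum u. KL_at (objective G R \<rho>) v) \<and>
     (\<exists>\<sigma>>0. strongly_convex_on \<sigma> (interior (edom h)) (\<lambda>x. real_of_ereal (h x))) \<and>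
     \<rho> differentiable_on UNIV \<and> continuous_on UNIV (\<lambda>v. jacobian \<rho> (at v)) \<and>
     local_lipschitz (UNIV :: real set) (interior (edom h))
       (\<lambda>_ x. (1 / \<tau>) *\<^sub>R egrad h x - egrad G x) \<and>
     closure {\<rho> (u k) | k. 1 \<le> k} \<subseteq> interior (edom h) \<and>
     (\<forall>k. 0 \<in> limiting_subdiff (surrogate h G R \<rho> \<tau> (u k)) (u (Suc k))) \<and>
     \<tau> < 1 / L"

end

theory Submission
  imports Defs
begin

text \<open>
  Since \<open>L h - G\<close> is convex and \<open>h\<close> is strongly convex, each step decreases \<open>E\<close> by at least
  \<open>a \<parallel>z\<^sub>k\<^sub>+\<^sub>1 - z\<^sub>k\<parallel>\<^sup>2\<close>. The optimality condition of the subproblem and the Lipschitz continuity of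
  \<open>(1/\<tau>) \<nabla>h - \<nabla>G\<close> yield a limiting subgradient of \<open>E\<close> at \<open>u\<^sub>k\<^sub>+\<^sub>1\<close> of norm at most
  \<open>M \<parallel>z\<^sub>k\<^sub>+\<^sub>1 - z\<^sub>k\<parallel>\<close>. Combining both with the KL inequality, made uniform on the compact set
  of accumulation points of \<open>u\<close>, where \<open>E\<close> is constant, bounds \<open>\<Sum>\<^sub>k \<parallel>z\<^sub>k\<^sub>+\<^sub>1 - z\<^sub>k\<parallel>\<close>; so \<open>z\<close>
  converges even though \<open>u\<close> need not. Stationarity follows by passing to the limit in the
  optimality conditions along a subsequence of \<open>u\<close>, the limiting subdifferential being closed.
\<close>

subsection \<open>Convex functions and essential smoothness\<close>

text \<open>The point \<open>(x, f x)\<close> is separated from the strict epigraph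
  \<open>T\<close>. Openness of \<open>S\<close> forces the normal \<open>(p, q)\<close> to have
  \<open>q > 0\<close>, and scaling \<open>p\<close> by \<open>- (1 / q)\<close> gives the
  subgradient.\<close>

lemma convex_on_subgradient_exists:
  fixes f :: "'a::euclidean_space \<Rightarrow> real"
  assumes "open S" "convex_on S f" "x \<in> S"
  shows "\<exists>v. \<forall>y\<in>S. f x + v \<bullet> (y - x) \<le> f y"
proof -
  define T where "T = {(y, r). y \<in> S \<and> f y < r}"
  have "convex S" using assms(2) by (rule convex_on_imp_convex)
  have "convex T"
    unfolding convex_alt
  proof (clarsimp simp: T_def, intro conjI)
    fix y r y' r' and t :: real
    assume *: "y \<in> S" "f y < r" "y' \<in> S" "f y' < r'" "0 \<le> t" "t \<le> 1"
    show "(1 - t) *\<^sub>R y + t *\<^sub>R y' \<in> S"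
      using \<open>convex S\<close> * by (simp add: convex_alt)
    have "f ((1 - t) *\<^sub>R y + t *\<^sub>R y') \<le> (1 - t) * f y + t * f y'"
      using convex_onD[OF assms(2), of t y y'] * by simp
    also have "\<dots> < (1 - t) * r + t * r'"
    proof (cases "t = 0")
      case False
      then have "t * f y' < t * r'" using * by simp
      moreover have "(1 - t) * f y \<le> (1 - t) * r" using * by (intro mult_left_mono) auto
      ultimately show ?thesis by linarith
    qed (use * in simp)
    finally show "f ((1 - t) *\<^sub>R y + t *\<^sub>R y') < (1 - t) * r + t * r'" .
  qed
  moreover have "(x, f x + 1) \<in> T" using assms by (simp add: T_def)
  moreover have "{(x, f x)} \<inter> T = {}" by (auto simp: T_def)
  ultimately obtain a b where ab: "a \<noteq> 0" "a \<bullet> (x, f x) \<le> b" "\<And>z. z \<in> T \<Longrightarrow> b \<le> a \<bullet> z"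
    using separating_hyperplane_sets[of "{(x, f x)}" T]
    by (metis convex_singleton empty_iff insertI1 insert_not_empty)
  obtain p q where a: "a = (p, q)" by (cases a)
  have sep: "p \<bullet> x + q * f x \<le> p \<bullet> y + q * r" if "y \<in> S" "f y < r" for y r
    using ab(2) ab(3)[of "(y, r)"] that by (simp add: a T_def)
  have "0 \<le> q" using sep[of x "f x + 1"] assms(3) by (simp add: algebra_simps)
  moreover have "q \<noteq> 0"
  proof
    assume "q = 0"
    then have "p \<noteq> 0" using ab(1) a by (simp add: zero_prod_def)
    obtain e where e: "0 < e" "cball x e \<subseteq> S" using assms open_contains_cball by blast
    \<comment> \<open>If \<open>q = 0\<close>, a step of length \<open>e\<close> against
      \<open>p\<close> stays in \<open>S\<close> but strictly decreases the inner product with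
      \<open>p\<close>.\<close>
    define y where "y = x - (e / norm p) *\<^sub>R p"
    have "y \<in> S" using e \<open>p \<noteq> 0\<close> by (intro subsetD[OF e(2)]) (simp add: y_def dist_norm)
    then have "p \<bullet> x \<le> p \<bullet> y" using sep[of y "f y + 1"] \<open>q = 0\<close> by simp
    moreover have "0 < (e / norm p) * (p \<bullet> p)" using e \<open>p \<noteq> 0\<close> by simp
    ultimately show False by (simp add: y_def inner_diff_right)
  qed
  ultimately have "0 < q" by simp
  \<comment> \<open>\<open>T\<close> contains only points strictly above the graph, so the
    inequality first comes with a slack \<open>e\<close>.\<close>
  have "f x + (- (1 / q) *\<^sub>R p) \<bullet> (y - x) \<le> f y" if "y \<in> S" for y
  proof (rule field_le_epsilon)
    fix e :: real assume "0 < e"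
    then have "p \<bullet> x + q * f x \<le> p \<bullet> y + q * (f y + e)" using sep[OF that] by simp
    then show "f x + (- (1 / q) *\<^sub>R p) \<bullet> (y - x) \<le> f y + e"
      using \<open>0 < q\<close> by (simp add: field_simps inner_diff_right)
  qed
  then show ?thesis by blast
qed

lemma proper_fun_ereal_real: "proper_fun f \<Longrightarrow> x \<in> edom f \<Longrightarrow> ereal (real_of_ereal (f x)) = f x"
  by (auto simp: proper_fun_def edom_def ereal_real)

lemma convex_fun_imp_convex_on:
  assumes "proper_fun f" "convex_fun f" "convex S" "S \<subseteq> edom f"
  shows "convex_on S (\<lambda>x. real_of_ereal (f x))"
proof (rule convex_onI)
  fix t :: real and x y assume *: "0 < t" "t < 1" "x \<in> S" "y \<in> S"
  let ?z = "(1 - t) *\<^sub>R x + t *\<^sub>R y"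
  have "?z \<in> S" using assms(3) * by (simp add: convex_alt)
  then have "f ?z = ereal (real_of_ereal (f ?z))" "f x = ereal (real_of_ereal (f x))"
    "f y = ereal (real_of_ereal (f y))"
    using assms * by (simp_all add: proper_fun_ereal_real subset_iff)
  then obtain a b c where abc: "f ?z = ereal a" "f x = ereal b" "f y = ereal c" by blast
  have "f ?z \<le> ereal (1 - t) * f x + ereal t * f y"
    using assms(2) * by (simp add: convex_fun_def)
  then show "real_of_ereal (f ?z) \<le> (1 - t) * real_of_ereal (f x) + t * real_of_ereal (f y)"
    by (simp add: abc)
qed (use assms in simp)

lemma convex_edom:
  assumes "proper_fun f" "convex_fun f"
  shows "convex (edom f)"
  unfolding convex_alt
proof (intro ballI allI impI)
  fix x y and t :: real assume *: "x \<in> edom f" "y \<in> edom f" "0 \<le> t \<and> t \<le> 1"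
  show "(1 - t) *\<^sub>R x + t *\<^sub>R y \<in> edom f"
  proof (cases "t = 0 \<or> t = 1")
    case False
    then have "f ((1 - t) *\<^sub>R x + t *\<^sub>R y) \<le> ereal (1 - t) * f x + ereal t * f y"
      using assms(2) * by (simp add: convex_fun_def)
    also have "\<dots> < \<infinity>"
      using proper_fun_ereal_real[OF assms(1) *(1), symmetric]
        proper_fun_ereal_real[OF assms(1) *(2), symmetric]
      by (cases "f x"; cases "f y") auto
    finally show ?thesis by (simp add: edom_def)
  qed (use * in auto)
qed

text \<open>For convex functions the local inequality is global: a point of the segment from
  \<open>x\<close> to \<open>y\<close> close to \<open>x\<close> lies in \<open>S\<close>, and
  convexity along the segment carries the inequality to \<open>y\<close> after division by
  \<open>t\<close>.\<close>

lemma convex_subdiff_localI: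
  fixes f :: "'a::euclidean_space \<Rightarrow> ereal"
  assumes f: "proper_fun f" "convex_fun f" and S: "open S" "S \<subseteq> edom f" "x \<in> S"
    and v: "\<And>y. y \<in> S \<Longrightarrow> real_of_ereal (f x) + v \<bullet> (y - x) \<le> real_of_ereal (f y)"
  shows "v \<in> convex_subdiff f x"
proof -
  have "f x + ereal (v \<bullet> (y - x)) \<le> f y" for y
  proof (cases "y \<in> edom f")
    case True
    obtain r s where r: "f x = ereal r" and s: "f y = ereal s"
      using proper_fun_ereal_real[OF f(1)] S True by (metis subsetD)
    have "((\<lambda>t. (1 - t) *\<^sub>R x + t *\<^sub>R y) \<longlongrightarrow> (1 - 0) *\<^sub>R x + 0 *\<^sub>R y) (at_right 0)"
      by (intro tendsto_intros)
    then have "eventually (\<lambda>t. (1 - t) *\<^sub>R x + t *\<^sub>R y \<in> S) (at_right 0)"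
      using S by (auto dest!: topological_tendstoD)
    then have "eventually (\<lambda>t. (1 - t) *\<^sub>R x + t *\<^sub>R y \<in> S \<and> t \<in> {0<..<1}) (at_right (0::real))"
      using eventually_at_right_real[of 0 1] by (simp add: eventually_conj)
    then obtain t :: real where t: "(1 - t) *\<^sub>R x + t *\<^sub>R y \<in> S" "0 < t" "t < 1"
      by (auto dest: eventually_happens)
    let ?z = "(1 - t) *\<^sub>R x + t *\<^sub>R y"
    have "f ?z = ereal (real_of_ereal (f ?z))"
      using t S f by (simp add: proper_fun_ereal_real subset_iff)
    then obtain q where q: "f ?z = ereal q" by blast
    have "f ?z \<le> ereal (1 - t) * f x + ereal t * f y"
      using f(2) t by (simp add: convex_fun_def)
    then have "real_of_ereal (f ?z) \<le> (1 - t) * r + t * s"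
      by (simp add: r s q)
    moreover have "?z - x = t *\<^sub>R (y - x)" by (simp add: algebra_simps)
    ultimately have "r + t * (v \<bullet> (y - x)) \<le> (1 - t) * r + t * s"
      using v[OF t(1)] by (simp add: r)
    then have "t * (r + v \<bullet> (y - x)) \<le> t * s" by (simp add: algebra_simps)
    then show ?thesis using t by (simp add: r s)
  qed (simp add: edom_def)
  then show ?thesis using S by (auto simp: convex_subdiff_def)
qed

lemma convex_subdiff_interior_nonempty:
  fixes f :: "'a::euclidean_space \<Rightarrow> ereal"
  assumes "proper_fun f" "convex_fun f" "x \<in> interior (edom f)"
  shows "convex_subdiff f x \<noteq> {}"
proof -
  let ?S = "interior (edom f)"
  have "convex_on ?S (\<lambda>x. real_of_ereal (f x))"
    using assms by (intro convex_fun_imp_convex_on convex_interior convex_edom interior_subset)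
  from convex_on_subgradient_exists[OF open_interior this assms(3)]
  show ?thesis
    using convex_subdiff_localI[OF assms(1,2) open_interior interior_subset assms(3)] by blast
qed

lemma convex_subdiff_realD:
  assumes "proper_fun f" "v \<in> convex_subdiff f x" "y \<in> edom f"
  shows "real_of_ereal (f x) + v \<bullet> (y - x) \<le> real_of_ereal (f y)"
proof -
  have "f x = ereal (real_of_ereal (f x))" "f y = ereal (real_of_ereal (f y))"
    using assms by (simp_all add: proper_fun_ereal_real convex_subdiff_def)
  then obtain a b where ab: "f x = ereal a" "f y = ereal b" by blast
  have "f x + ereal (v \<bullet> (y - x)) \<le> f y" using assms(2) by (simp add: convex_subdiff_def)
  then show ?thesis by (simp add: ab)
qed

section \<open>Gradients and smoothness of convex functions\<close>

lemma GDERIV_unique: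
  assumes "GDERIV f x :> a" "GDERIV f x :> b"
  shows "a = b"
proof -
  have "(\<lambda>h. h \<bullet> a) = (\<lambda>h. h \<bullet> b)"
    using assms by (auto simp: gderiv_def intro: has_derivative_unique)
  then have "(a - b) \<bullet> (a - b) = 0"
    by (metis (mono_tags, lifting) inner_diff_right right_minus_eq)
  then show ?thesis by simp
qed

lemma egrad_eqI: "GDERIV (\<lambda>y. real_of_ereal (f y)) x :> g \<Longrightarrow> egrad f x = g"
  unfolding egrad_def by (rule the_equality) (auto intro: GDERIV_unique)

text \<open>The Riesz representative of the derivative \<open>D\<close> is the sum of
  \<open>D b *\<^sub>R b\<close> over the basis; uniqueness of gradients identifies it with the
  description in \<open>egrad\<close>.\<close>

lemma GDERIV_egrad:
  fixes f :: "'a::euclidean_space \<Rightarrow> ereal"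
  assumes "(\<lambda>y. real_of_ereal (f y)) differentiable at x"
  shows "GDERIV (\<lambda>y. real_of_ereal (f y)) x :> egrad f x"
proof -
  obtain D where D: "((\<lambda>y. real_of_ereal (f y)) has_derivative D) (at x)"
    using assms by (auto simp: differentiable_def)
  have "bounded_linear D" using D by (rule has_derivative_bounded_linear)
  then have "linear D" by (rule bounded_linear.linear)
  have "D h = h \<bullet> (\<Sum>b\<in>Basis. D b *\<^sub>R b)" for h
  proof -
    have "D h = D (\<Sum>b\<in>Basis. (h \<bullet> b) *\<^sub>R b)" by (simp add: euclidean_representation)
    also have "\<dots> = (\<Sum>b\<in>Basis. (h \<bullet> b) * D b)"
      using \<open>linear D\<close> by (simp add: linear_sum linear_cmul)
    finally show ?thesis by (simp add: inner_sum_right mult.commute)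
  qed
  then have "D = (\<lambda>h. h \<bullet> (\<Sum>b\<in>Basis. D b *\<^sub>R b))" by blast
  then have "GDERIV (\<lambda>y. real_of_ereal (f y)) x :> (\<Sum>b\<in>Basis. D b *\<^sub>R b)"
    using D by (simp add: gderiv_def)
  then show ?thesis using egrad_eqI by metis
qed

text \<open>On the interior of the domain the subdifferential is single-valued and locally bounded
  and has a closed graph. A map with closed graph into a compact set is continuous, so the unique
  selection \<open>g\<close> is continuous.\<close>

lemma essentially_smooth_gradient:
  fixes f :: "'a::euclidean_space \<Rightarrow> ereal"
  assumes f: "proper_fun f" "convex_fun f" "essentially_smooth f"
  obtains g where "continuous_on (interior (edom f)) g"
    and "\<And>x. x \<in> interior (edom f) \<Longrightarrow> g x \<in> convex_subdiff f x"
proof -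
  let ?S = "interior (edom f)"
  let ?r = "\<lambda>x. real_of_ereal (f x)"
  have uniq: "\<exists>!v. v \<in> convex_subdiff f x" if "x \<in> ?S" for x
    using f(3) convex_subdiff_interior_nonempty[OF f(1,2) that]
    by (simp add: essentially_smooth_def)
  define g where "g x = (THE v. v \<in> convex_subdiff f x)" for x
  have g: "g x \<in> convex_subdiff f x" if "x \<in> ?S" for x
    unfolding g_def using uniq[OF that] by (rule theI')
  have cont: "continuous_on ?S ?r"
    using f by (intro convex_on_continuous open_interior convex_fun_imp_convex_on convex_interior
        convex_edom interior_subset)
  have "isCont g x" if x: "x \<in> ?S" for x
  proof -
    obtain U where U: "open U" "x \<in> U" "bounded (\<Union>y\<in>U. convex_subdiff f y)"
      using f(3)[unfolded essentially_smooth_def, rule_format,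
          OF convex_subdiff_interior_nonempty[OF f(1,2) x]] by auto
    obtain e where e: "0 < e" "cball x e \<subseteq> U \<inter> ?S"
      using U x by (meson IntI open_Int open_contains_cball open_interior)
    let ?K = "closure (\<Union>y\<in>U. convex_subdiff f y)"
    have "continuous_on (cball x e) g"
    proof (rule continuous_from_closed_graph)
      show "compact ?K" using U by simp
      show "g \<in> cball x e \<rightarrow> ?K" using g e closure_subset by fastforce
      show "closed ((\<lambda>y. (y, g y)) ` cball x e)"
        unfolding closed_sequential_limits
      proof (intro allI impI, elim conjE)
        fix X l assume X: "\<forall>n. X n \<in> (\<lambda>y. (y, g y)) ` cball x e" and lim: "X \<longlonglongrightarrow> l"
        obtain a v where l: "l = (a, v)" by (cases l)
        have a: "(\<lambda>n. fst (X n)) \<longlonglongrightarrow> a" and v: "(\<lambda>n. snd (X n)) \<longlonglongrightarrow> v"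
          using tendsto_fst[OF lim] tendsto_snd[OF lim] by (auto simp: l)
        have Xn: "fst (X n) \<in> cball x e" "snd (X n) = g (fst (X n))" for n
          using X[rule_format, of n] by auto
        have XnS: "fst (X n) \<in> ?S" for n using Xn(1)[of n] e(2) by blast
        have "a \<in> cball x e"
          using closed_sequentially[OF closed_cball _ a] Xn by simp
        then have aS: "a \<in> ?S" using e by blast
        \<comment> \<open>The subgradient inequalities at \<open>fst (X n)\<close> pass to the
          limit, since \<open>f\<close> is continuous on the interior; uniqueness then gives
          \<open>v = g a\<close>.\<close>
        have "v \<in> convex_subdiff f a"
        proof (rule convex_subdiff_localI[OF f(1,2) open_interior interior_subset aS])
          fix y assume y: "y \<in> ?S"
          have "(\<lambda>n. ?r (fst (X n))) \<longlonglongrightarrow> ?r a"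
            using continuous_on_tendsto_compose[OF cont a aS] XnS by simp
          then have "(\<lambda>n. ?r (fst (X n)) + snd (X n) \<bullet> (y - fst (X n))) \<longlonglongrightarrow> ?r a + v \<bullet> (y - a)"
            using a v by (intro tendsto_add tendsto_inner tendsto_diff tendsto_const)
          moreover have "?r (fst (X n)) + snd (X n) \<bullet> (y - fst (X n)) \<le> ?r y" for n
            unfolding Xn(2)
            by (rule convex_subdiff_realD[OF f(1) g[OF XnS] subsetD[OF interior_subset y]])
          ultimately show "?r a + v \<bullet> (y - a) \<le> ?r y"
            by (intro LIMSEQ_le_const2) auto
        qed
        then have "v = g a" using uniq[OF aS] g[OF aS] by blast
        then show "l \<in> (\<lambda>y. (y, g y)) ` cball x e" using \<open>a \<in> cball x e\<close> l by blast
      qed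
    qed
    then show ?thesis
      using e(1) by (intro continuous_on_interior[of "cball x e"]) auto
  qed
  then have "continuous_on ?S g" by (simp add: continuous_at_imp_continuous_on)
  then show thesis using g that by blast
qed

text \<open>The subgradient inequalities at \<open>x\<close> and at \<open>y\<close> squeeze the
  first-order remainder between \<open>0\<close> and \<open>(g y - g x) \<bullet> (y - x)\<close>,
  which is small relative to \<open>norm (y - x)\<close> by continuity of \<open>g\<close>. Hence
  \<open>g\<close> is the gradient.\<close>

lemma essentially_smooth_GDERIV:
  fixes f :: "'a::euclidean_space \<Rightarrow> ereal"
  assumes f: "proper_fun f" "convex_fun f" "essentially_smooth f"
  shows "x \<in> interior (edom f) \<Longrightarrow> GDERIV (\<lambda>y. real_of_ereal (f y)) x :> egrad f x"
    and "continuous_on (interior (edom f)) (egrad f)"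
proof -
  let ?S = "interior (edom f)"
  let ?r = "\<lambda>x. real_of_ereal (f x)"
  obtain g where cont: "continuous_on ?S g" and g: "\<And>x. x \<in> ?S \<Longrightarrow> g x \<in> convex_subdiff f x"
    using essentially_smooth_gradient[OF f] by blast
  have sub: "?S \<subseteq> edom f" by (rule interior_subset)
  have G: "GDERIV ?r x :> g x" if x: "x \<in> ?S" for x
    unfolding gderiv_def has_derivative_at_alt
  proof (intro conjI allI impI)
    fix e :: real assume "0 < e"
    have "isCont g x" using cont x by (simp add: continuous_on_eq_continuous_at)
    then have "eventually (\<lambda>y. dist (g y) (g x) < e) (nhds x)"
      using \<open>0 < e\<close> by (simp add: isCont_def tendsto_iff eventually_at_filter eventually_mono)
        (auto elim!: eventually_mono)
    moreover have "eventually (\<lambda>y. y \<in> ?S) (nhds x)" using x by (simp add: eventually_nhds_in_open)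
    ultimately have "eventually (\<lambda>y. dist (g y) (g x) < e \<and> y \<in> ?S) (nhds x)"
      by (rule eventually_conj)
    then obtain d where d: "0 < d" "\<And>y. dist y x < d \<Longrightarrow> dist (g y) (g x) < e \<and> y \<in> ?S"
      by (auto simp: eventually_nhds_metric)
    have "norm (?r y - ?r x - (y - x) \<bullet> g x) \<le> e * norm (y - x)" if "norm (y - x) < d" for y
    proof -
      have y: "y \<in> ?S" "norm (g y - g x) \<le> e" using d(2)[of y] that by (auto simp: dist_norm)
      have 1: "?r x + g x \<bullet> (y - x) \<le> ?r y"
        using convex_subdiff_realD[OF f(1) g[OF x]] y sub by blast
      have "?r y + g y \<bullet> (x - y) \<le> ?r x"
        using convex_subdiff_realD[OF f(1) g[OF y(1)]] x sub by blast
      then have "?r y - ?r x - (y - x) \<bullet> g x \<le> (g y - g x) \<bullet> (y - x)"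
        by (simp add: algebra_simps inner_commute)
      also have "\<dots> \<le> norm (g y - g x) * norm (y - x)" by (rule norm_cauchy_schwarz)
      also have "\<dots> \<le> e * norm (y - x)" using y by (intro mult_right_mono) auto
      finally show ?thesis using 1 by (simp add: inner_commute)
    qed
    then show "\<exists>d>0. \<forall>y. norm (y - x) < d \<longrightarrow>
        norm (?r y - ?r x - (y - x) \<bullet> g x) \<le> e * norm (y - x)"
      using d(1) by blast
  qed (rule bounded_linear_inner_left)
  then have eq: "egrad f x = g x" if "x \<in> ?S" for x using that by (blast intro: egrad_eqI)
  then show "x \<in> ?S \<Longrightarrow> GDERIV ?r x :> egrad f x" using G by simp
  show "continuous_on ?S (egrad f)" using cont eq by (simp cong: continuous_on_cong)
qed

text \<open>Divide the strong convexity inequality on the segment from \<open>x\<close> to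
  \<open>y\<close> by \<open>t\<close> and let \<open>t\<close> decrease to
  \<open>0\<close>.\<close>

lemma strongly_convex_on_ge_tangent:
  fixes f :: "'a::real_inner \<Rightarrow> real"
  assumes f: "strongly_convex_on \<sigma> S f" and "x \<in> S" "y \<in> S" and g: "GDERIV f x :> g"
  shows "f x + g \<bullet> (y - x) + \<sigma> / 2 * (norm (y - x))\<^sup>2 \<le> f y"
proof -
  have "((\<lambda>t. x + t *\<^sub>R (y - x)) has_vector_derivative (y - x)) (at 0)"
    by (auto intro!: derivative_eq_intros)
  moreover have "(f has_derivative (\<lambda>h. h \<bullet> g)) (at (x + 0 *\<^sub>R (y - x)))"
    using g by (simp add: gderiv_def)
  ultimately have "((\<lambda>t. f (x + t *\<^sub>R (y - x))) has_real_derivative ((y - x) \<bullet> g)) (at 0)"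
    using vector_derivative_diff_chain_within[of "\<lambda>t. x + t *\<^sub>R (y - x)" "y - x" 0 UNIV f "\<lambda>h. h \<bullet> g"]
    by (simp add: o_def has_real_derivative_iff_has_vector_derivative has_derivative_at_withinI)
  then have "(\<lambda>t. (f (x + t *\<^sub>R (y - x)) - f x) / t) \<midarrow>0\<rightarrow> (y - x) \<bullet> g"
    by (simp add: DERIV_def)
  then have l1: "((\<lambda>t. (f (x + t *\<^sub>R (y - x)) - f x) / t) \<longlongrightarrow> (y - x) \<bullet> g) (at_right 0)"
    by (rule filterlim_mono) (auto intro: at_le)
  have l2: "((\<lambda>t. f y - f x - \<sigma> / 2 * (1 - t) * (norm (y - x))\<^sup>2) \<longlongrightarrow>
      f y - f x - \<sigma> / 2 * (1 - 0) * (norm (y - x))\<^sup>2) (at_right 0)"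
    by (intro tendsto_intros)
  have "eventually (\<lambda>t::real. t \<in> {0<..<1}) (at_right 0)"
    by (rule eventually_at_right_real) simp
  then have "eventually (\<lambda>t. (f (x + t *\<^sub>R (y - x)) - f x) / t
      \<le> f y - f x - \<sigma> / 2 * (1 - t) * (norm (y - x))\<^sup>2) (at_right 0)"
  proof eventually_elim
    case (elim t)
    have "f ((1 - t) *\<^sub>R x + t *\<^sub>R y)
       \<le> (1 - t) * f x + t * f y - \<sigma> / 2 * t * (1 - t) * (norm (x - y))\<^sup>2"
      using f assms(2,3) elim by (simp add: strongly_convex_on_def)
    moreover have "(1 - t) *\<^sub>R x + t *\<^sub>R y = x + t *\<^sub>R (y - x)" by (simp add: algebra_simps)
    ultimately have "f (x + t *\<^sub>R (y - x)) - f x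
        \<le> t * (f y - f x - \<sigma> / 2 * (1 - t) * (norm (y - x))\<^sup>2)"
      by (simp add: algebra_simps norm_minus_commute)
    then show ?case using elim by (simp add: pos_divide_le_eq mult.commute)
  qed
  from tendsto_le[OF _ l2 l1 this] show ?thesis by (simp add: inner_commute)
qed

text \<open>Lets the tangent inequality above also serve the merely convex function
  \<open>L h - G\<close>.\<close>

lemma convex_on_imp_strongly_convex_on_0: "convex_on S f \<Longrightarrow> strongly_convex_on 0 S f"
  by (auto simp: strongly_convex_on_def convex_onD dest: convex_on_imp_convex)

subsection \<open>Limiting subgradients\<close>

text \<open>Clearing the denominator turns the liminf of extended-real quotients into an inequality
  with slack \<open>e * norm (y - x)\<close>, to which first-order expansions can be added.\<close>

lemma frechet_subdiff_iff:
  assumes "f x \<noteq> -\<infinity>"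
  shows "v \<in> frechet_subdiff f x \<longleftrightarrow> x \<in> edom f \<and>
    (\<forall>e>0. eventually (\<lambda>y. f x + ereal (v \<bullet> (y - x) - e * norm (y - x)) \<le> f y) (at x))"
proof (cases "x \<in> edom f")
  case True
  then obtain r where r: "f x = ereal r" using assms by (cases "f x") (auto simp: edom_def)
  let ?q = "\<lambda>y. (f y - f x - ereal (v \<bullet> (y - x))) / ereal (norm (y - x))"
  have ne: "eventually (\<lambda>y. y \<noteq> x) (at x)" by (simp add: eventually_at_filter)
  have quot: "ereal (- e) \<le> ?q y \<longleftrightarrow> f x + ereal (v \<bullet> (y - x) - e * norm (y - x)) \<le> f y"
    if "y \<noteq> x" for y and e :: real
  proof (cases "f y")
    case (real s)
    have "0 < norm (y - x)" using that by simp
    then have "- e \<le> (s - r - v \<bullet> (y - x)) / norm (y - x)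
      \<longleftrightarrow> r + (v \<bullet> (y - x) - e * norm (y - x)) \<le> s"
      by (simp add: pos_le_divide_eq) linarith
    then show ?thesis using that by (simp add: r real)
  next
    case PInf
    then show ?thesis using that by (simp add: r)
  next
    case MInf
    then show ?thesis using that by (simp add: r)
  qed
  have "0 \<le> Liminf (at x) ?q \<longleftrightarrow> (\<forall>e>0. eventually (\<lambda>y. ereal (- e) \<le> ?q y) (at x))"
  proof
    assume *: "0 \<le> Liminf (at x) ?q"
    show "\<forall>e>0. eventually (\<lambda>y. ereal (- e) \<le> ?q y) (at x)"
    proof (intro allI impI)
      fix e :: real assume "0 < e"
      then have "ereal (- e) < 0" by simp
      then have "eventually (\<lambda>y. ereal (- e) < ?q y) (at x)" using * by (simp only: le_Liminf_iff)
      then show "eventually (\<lambda>y. ereal (- e) \<le> ?q y) (at x)"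
        by eventually_elim (rule less_imp_le)
    qed
  next
    assume *: "\<forall>e>0. eventually (\<lambda>y. ereal (- e) \<le> ?q y) (at x)"
    show "0 \<le> Liminf (at x) ?q"
      unfolding le_Liminf_iff
    proof (intro allI impI)
      fix c :: ereal assume "c < 0"
      then obtain d where "c < ereal d" "ereal d < 0" using ereal_dense2 by blast
      then have "eventually (\<lambda>y. ereal d \<le> ?q y) (at x)"
        using *[rule_format, of "- d"] by simp
      then show "eventually (\<lambda>y. c < ?q y) (at x)"
        by eventually_elim (use \<open>c < ereal d\<close> in \<open>rule less_le_trans\<close>)
    qed
  qed
  also have "\<dots> \<longleftrightarrow> (\<forall>e>0. eventually
      (\<lambda>y. f x + ereal (v \<bullet> (y - x) - e * norm (y - x)) \<le> f y) (at x))"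
    by (intro all_cong1 imp_cong refl eventually_subst eventually_mono[OF ne] quot)
  finally show ?thesis using True by (simp add: frechet_subdiff_def)
qed (simp add: frechet_subdiff_def)

text \<open>Half of the slack \<open>e\<close> is spent on the subgradient inequality for
  \<open>f\<close>, the other half on the first-order remainder of \<open>s\<close>.\<close>

lemma frechet_subdiff_add_smooth:
  assumes f: "f x \<noteq> -\<infinity>" and F: "eventually (\<lambda>y. F y = f y + ereal (s y)) (nhds x)"
    and s: "GDERIV s x :> g" and v: "v \<in> frechet_subdiff f x"
  shows "v + g \<in> frechet_subdiff F x"
proof -
  have Fx: "F x = f x + ereal (s x)" using F by (rule eventually_nhds_x_imp_x)
  have "x \<in> edom f" using v by (simp add: frechet_subdiff_def)
  then obtain r where r: "f x = ereal r" using f by (cases "f x") (auto simp: edom_def)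
  have "eventually (\<lambda>y. F x + ereal ((v + g) \<bullet> (y - x) - e * norm (y - x)) \<le> F y) (at x)"
    if "0 < e" for e
  proof -
    have 1: "eventually (\<lambda>y. f x + ereal (v \<bullet> (y - x) - e / 2 * norm (y - x)) \<le> f y) (at x)"
      using v half_gt_zero[OF that] unfolding frechet_subdiff_iff[of f, OF f] by blast
    have "0 < e / 2" using that by simp
    then obtain d where "0 < d"
      and d: "\<And>y. norm (y - x) < d \<Longrightarrow> norm (s y - s x - (y - x) \<bullet> g) \<le> e / 2 * norm (y - x)"
      using s unfolding gderiv_def has_derivative_at_alt by blast
    then have 2: "eventually (\<lambda>y. norm (s y - s x - (y - x) \<bullet> g) \<le> e / 2 * norm (y - x)) (at x)"
      by (auto simp: eventually_at dist_norm)
    have 3: "eventually (\<lambda>y. F y = f y + ereal (s y)) (at x)"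
      using F by (simp add: eventually_at_filter eventually_mono)
    show ?thesis
      using 1 2 3
    proof eventually_elim
      case (elim y)
      then show ?case
        by (cases "f y") (auto simp: Fx r algebra_simps inner_commute abs_if split: if_splits)
    qed
  qed
  moreover have "x \<in> edom F" "F x \<noteq> -\<infinity>" by (auto simp: edom_def Fx r)
  ultimately show ?thesis by (simp add: frechet_subdiff_iff)
qed

text \<open>Continuity of \<open>g\<close> carries the Frechet sum rule to limits. It serves to
  strip the smooth model off the surrogate, leaving \<open>R\<close>, and to add \<open>G\<close>
  composed with \<open>\<rho>\<close> to \<open>R\<close>, giving the objective.\<close>

lemma limiting_subdiff_add_smooth:
  fixes f F :: "'a::real_inner \<Rightarrow> ereal"
  assumes f: "\<And>y. y \<in> S \<Longrightarrow> f y \<noteq> -\<infinity>" and S: "open S" "x \<in> S"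
    and F: "\<And>y. y \<in> S \<Longrightarrow> F y = f y + ereal (s y)"
    and s: "\<And>y. y \<in> S \<Longrightarrow> GDERIV s y :> g y" "continuous_on S g"
    and v: "v \<in> limiting_subdiff f x"
  shows "v + g x \<in> limiting_subdiff F x"
proof -
  obtain xs vs where xs: "xs \<longlonglongrightarrow> x" "(\<lambda>i. f (xs i)) \<longlonglongrightarrow> f x"
    and vs: "\<And>i. vs i \<in> frechet_subdiff f (xs i)" "vs \<longlonglongrightarrow> v" and x: "x \<in> edom f"
    using v by (auto simp: limiting_subdiff_def)
  obtain N where N: "\<And>i. N \<le> i \<Longrightarrow> xs i \<in> S"
    using topological_tendstoD[OF xs(1) S] by (auto simp: eventually_sequentially)
  \<comment> \<open>The approximating sequence may start outside \<open>S\<close>, where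
    \<open>F\<close> and \<open>f\<close> are unrelated; its first \<open>N\<close> terms are
    dropped.\<close>
  let ?xs = "\<lambda>i. xs (i + N)" and ?vs = "\<lambda>i. vs (i + N) + g (xs (i + N))"
  have XS: "?xs i \<in> S" for i using N by simp
  have lim: "?xs \<longlonglongrightarrow> x" "(\<lambda>i. f (?xs i)) \<longlonglongrightarrow> f x" "(\<lambda>i. vs (i + N)) \<longlonglongrightarrow> v"
    using xs vs by (auto intro: LIMSEQ_ignore_initial_segment)
  obtain r where r: "f x = ereal r" using f[OF S(2)] x by (cases "f x") (auto simp: edom_def)
  have "isCont s x"
    using s(1)[OF S(2)] unfolding gderiv_def by (rule has_derivative_continuous)
  then have "(\<lambda>i. s (?xs i)) \<longlonglongrightarrow> s x" using lim(1) by (rule isCont_tendsto_compose)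
  then have "(\<lambda>i. f (?xs i) + ereal (s (?xs i))) \<longlonglongrightarrow> f x + ereal (s x)"
    using lim(2) by (intro tendsto_add_ereal) (auto simp: r)
  then have "(\<lambda>i. F (?xs i)) \<longlonglongrightarrow> F x" using F XS S by simp
  moreover have "?vs \<longlonglongrightarrow> v + g x"
    using lim continuous_on_tendsto_compose[OF s(2) lim(1) S(2)] XS by (intro tendsto_add) auto
  moreover have "?vs i \<in> frechet_subdiff F (?xs i)" for i
    using S XS[of i] f F s vs
    by (intro frechet_subdiff_add_smooth[where s = s and f = f])
      (auto simp: eventually_nhds)
  moreover have "x \<in> edom F" using F[OF S(2)] by (simp add: edom_def r)
  ultimately show ?thesis
    using lim(1) unfolding limiting_subdiff_def
    by (intro CollectI conjI exI[of _ ?xs] exI[of _ ?vs]) auto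
qed

lemma LIMSEQ_dist_le_inverse_Suc:
  assumes "X \<longlonglongrightarrow> l" "\<And>i. dist (Y i) (X i) < inverse (real (Suc i))"
  shows "Y \<longlonglongrightarrow> l"
proof -
  have "(\<lambda>i. dist (Y i) (X i)) \<longlonglongrightarrow> 0"
    by (rule tendsto_sandwich[OF _ _ tendsto_const LIMSEQ_inverse_real_of_nat])
      (use assms(2) in \<open>auto intro!: always_eventually less_imp_le\<close>)
  moreover have "(\<lambda>i. dist (X i) l) \<longlonglongrightarrow> 0" using assms(1) by (rule tendsto_dist_iff[THEN iffD1])
  ultimately have "(\<lambda>i. dist (Y i) (X i) + dist (X i) l) \<longlonglongrightarrow> 0 + 0" by (rule tendsto_add)
  then have lim: "(\<lambda>i. dist (Y i) (X i) + dist (X i) l) \<longlonglongrightarrow> 0" by simp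
  have "(\<lambda>i. dist (Y i) l) \<longlonglongrightarrow> 0"
    by (rule tendsto_sandwich[OF _ _ tendsto_const lim])
      (auto intro: always_eventually dist_triangle)
  then show ?thesis by (rule tendsto_dist_iff[THEN iffD2])
qed

text \<open>A diagonal argument: for each \<open>i\<close> a Frechet subgradient is chosen whose
  base point, slope and function value all lie within \<open>inverse (real (Suc i))\<close> of those
  at index \<open>i\<close>.\<close>

lemma limiting_subdiff_closed:
  fixes f :: "'a::real_inner \<Rightarrow> ereal"
  assumes f: "\<And>y. f y \<noteq> -\<infinity>" and x: "x \<in> edom f"
    and xs: "xs \<longlonglongrightarrow> x" "(\<lambda>i. f (xs i)) \<longlonglongrightarrow> f x"
    and vs: "\<And>i. vs i \<in> limiting_subdiff f (xs i)" "vs \<longlonglongrightarrow> v"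
  shows "v \<in> limiting_subdiff f x"
proof -
  let ?r = "\<lambda>x. real_of_ereal (f x)"
  have real: "f y = ereal (?r y)" if "y \<in> edom f" for y
    using that f by (cases "f y") (auto simp: edom_def)
  have "\<exists>y w. w \<in> frechet_subdiff f y \<and> dist y (xs i) < inverse (real (Suc i)) \<and>
      dist w (vs i) < inverse (real (Suc i)) \<and> dist (?r y) (?r (xs i)) < inverse (real (Suc i))" for i
  proof -
    obtain ys ws where *: "ys \<longlonglongrightarrow> xs i" "(\<lambda>j. f (ys j)) \<longlonglongrightarrow> f (xs i)"
        "\<And>j. ws j \<in> frechet_subdiff f (ys j)" "ws \<longlonglongrightarrow> vs i" and "xs i \<in> edom f"
      using vs(1)[of i] by (auto simp: limiting_subdiff_def)
    have "(\<lambda>j. ?r (ys j)) \<longlonglongrightarrow> ?r (xs i)"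
      using *(2) real[OF \<open>xs i \<in> edom f\<close>] by (intro lim_real_of_ereal) simp
    then have "eventually (\<lambda>j. dist (ys j) (xs i) < inverse (real (Suc i)) \<and>
        dist (ws j) (vs i) < inverse (real (Suc i)) \<and>
        dist (?r (ys j)) (?r (xs i)) < inverse (real (Suc i))) sequentially"
      using *(1,4) by (intro eventually_conj tendstoD) auto
    then obtain j where "dist (ys j) (xs i) < inverse (real (Suc i)) \<and>
        dist (ws j) (vs i) < inverse (real (Suc i)) \<and>
        dist (?r (ys j)) (?r (xs i)) < inverse (real (Suc i))"
      by (auto simp: eventually_sequentially)
    then show ?thesis using *(3)[of j] by blast
  qed
  then obtain ys ws where *: "\<And>i. ws i \<in> frechet_subdiff f (ys i)"
      "\<And>i. dist (ys i) (xs i) < inverse (real (Suc i))"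
      "\<And>i. dist (ws i) (vs i) < inverse (real (Suc i))"
      "\<And>i. dist (?r (ys i)) (?r (xs i)) < inverse (real (Suc i))"
    by metis
  have "ys \<longlonglongrightarrow> x" using xs(1) *(2) by (rule LIMSEQ_dist_le_inverse_Suc)
  moreover have "ws \<longlonglongrightarrow> v" using vs(2) *(3) by (rule LIMSEQ_dist_le_inverse_Suc)
  moreover have "(\<lambda>i. f (ys i)) \<longlonglongrightarrow> f x"
  proof -
    have "(\<lambda>i. ?r (xs i)) \<longlonglongrightarrow> ?r x" using xs(2) real[OF x] by (intro lim_real_of_ereal) simp
    then have "(\<lambda>i. ?r (ys i)) \<longlonglongrightarrow> ?r x" using *(4) by (rule LIMSEQ_dist_le_inverse_Suc)
    then have "(\<lambda>i. ereal (?r (ys i))) \<longlonglongrightarrow> ereal (?r x)" by simp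
    moreover have "ys i \<in> edom f" for i using *(1)[of i] by (simp add: frechet_subdiff_def)
    ultimately show ?thesis using real x by simp
  qed
  ultimately show ?thesis using x *(1) unfolding limiting_subdiff_def by blast
qed

subsection \<open>The Kurdyka--Lojasiewicz inequality\<close>

text \<open>The KL inequality at level \<open>c\<close> in integrated form: a chord
  \<open>\<phi> s - \<phi> t\<close> takes the place of the derivative times \<open>s - t\<close>.
  For monotone functions this form survives summation, and it is directly what the descent argument
  consumes.\<close>

definition desingularizing ::
  "('a::real_inner \<Rightarrow> ereal) \<Rightarrow> real \<Rightarrow> real \<Rightarrow> (real \<Rightarrow> real) \<Rightarrow> 'a set \<Rightarrow> bool" where
  "desingularizing f c \<eta> \<phi> U \<longleftrightarrow> 0 < \<eta> \<and> open U \<and>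
    (\<forall>s t. 0 \<le> t \<longrightarrow> t \<le> s \<longrightarrow> s < \<eta> \<longrightarrow> 0 \<le> \<phi> t \<and> \<phi> t \<le> \<phi> s) \<and>
    (\<forall>y\<in>U. \<forall>w\<in>limiting_subdiff f y. \<forall>s t. f y = ereal (c + s) \<longrightarrow> 0 < s \<longrightarrow> s < \<eta> \<longrightarrow>
      0 \<le> t \<longrightarrow> t \<le> s \<longrightarrow> s - t \<le> (\<phi> s - \<phi> t) * norm w)"

text \<open>A concave function lies below its tangents, so
  \<open>\<phi>' s * (s - t) \<le> \<phi> s - \<phi> t\<close>. Multiplying the KL inequality by
  \<open>s - t\<close> gives the chord form, the distance to the subdifferential being at most the
  norm of any of its members.\<close>

lemma KL_at_desingularizing:
  assumes "KL_at f x" and fx: "f x = ereal c"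
  shows "\<exists>\<eta> \<phi> U. desingularizing f c \<eta> \<phi> U \<and> x \<in> U"
proof -
  obtain \<eta> \<phi> \<phi>' U where \<eta>: "0 < \<eta>" and cont: "continuous_on {0..<\<eta>} \<phi>"
    and deriv: "\<And>s. s \<in> {0<..<\<eta>} \<Longrightarrow> (\<phi> has_real_derivative \<phi>' s) (at s)"
    and \<phi>0: "\<phi> 0 = 0" and conc: "concave_on {0..<\<eta>} \<phi>"
    and pos: "\<And>s. s \<in> {0<..<\<eta>} \<Longrightarrow> 0 < \<phi>' s"
    and U: "open U" "x \<in> U"
    and KL: "\<And>y. y \<in> U \<Longrightarrow> f x < f y \<Longrightarrow> f y < f x + ereal \<eta> \<Longrightarrow>
      1 \<le> ereal (\<phi>' (real_of_ereal (f y - f x))) * edist_set 0 (limiting_subdiff f y)"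
    using assms(1) unfolding KL_at_def by blast
  have tangent: "\<phi>' s * (s - t) \<le> \<phi> s - \<phi> t" if "0 < s" "s < \<eta>" "0 \<le> t" "t \<le> s" for s t
  proof -
    have "convex_on {0..<\<eta>} (\<lambda>t. - \<phi> t)" using conc by (simp add: concave_on_def)
    moreover have "((\<lambda>t. - \<phi> t) has_real_derivative - \<phi>' s) (at s within {0..<\<eta>})"
      using that by (intro has_field_derivative_at_within[OF DERIV_minus] deriv) auto
    ultimately have "- \<phi>' s * (t - s) \<le> - \<phi> t - - \<phi> s"
      using that by (intro convex_on_imp_above_tangent) auto
    then show ?thesis by (simp add: algebra_simps)
  qed
  have mono: "\<phi> t \<le> \<phi> s" if "0 \<le> t" "t \<le> s" "s < \<eta>" for s t
  proof (cases "s = 0")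
    case False
    then have "0 \<le> \<phi>' s * (s - t)" using that pos[of s] by auto
    then show ?thesis using tangent[of s t] False that by simp
  qed (use that in auto)
  have nonneg: "0 \<le> \<phi> t" if "0 \<le> t" "t < \<eta>" for t using mono[of 0 t] that \<phi>0 by simp
  have "s - t \<le> (\<phi> s - \<phi> t) * norm w"
    if y: "y \<in> U" "w \<in> limiting_subdiff f y" "f y = ereal (c + s)"
      and s: "0 < s" "s < \<eta>" "0 \<le> t" "t \<le> s" for y w s t
  proof -
    have "1 \<le> ereal (\<phi>' s) * edist_set 0 (limiting_subdiff f y)"
      using KL[OF y(1)] y(3) s by (simp add: fx)
    also have "\<dots> \<le> ereal (\<phi>' s) * ereal (norm w)"
      using y(2) pos[of s] s unfolding edist_set_def
      by (intro ereal_mult_left_mono INF_lower2[of w]) auto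
    finally have 1: "1 \<le> \<phi>' s * norm w" by (simp add: one_ereal_def)
    have "s - t \<le> \<phi>' s * norm w * (s - t)" using mult_right_mono[OF 1, of "s - t"] s by simp
    also have "\<dots> \<le> (\<phi> s - \<phi> t) * norm w"
      using mult_right_mono[OF tangent[OF s], of "norm w"] by (simp add: mult_ac)
    finally show ?thesis .
  qed
  then have "desingularizing f c \<eta> \<phi> U"
    using \<eta> U mono nonneg by (simp add: desingularizing_def)
  then show ?thesis using U by blast
qed

text \<open>The desingularizing functions of a finite cover are merged by adding them up.\<close>

lemma KL_uniformized:
  assumes "compact A" and KL: "\<And>x. x \<in> A \<Longrightarrow> KL_at f x" and c: "\<And>x. x \<in> A \<Longrightarrow> f x = ereal c"
  shows "\<exists>\<eta> \<phi> U. desingularizing f c \<eta> \<phi> U \<and> A \<subseteq> U"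
proof (cases "A = {}")
  case True
  then show ?thesis
    by (intro exI[of _ 1] exI[of _ "\<lambda>_. 0"] exI[of _ "{}"]) (simp add: desingularizing_def)
next
  case False
  obtain \<eta> \<phi> U where *: "\<And>x. x \<in> A \<Longrightarrow> desingularizing f c (\<eta> x) (\<phi> x) (U x) \<and> x \<in> U x"
    using KL_at_desingularizing KL c by metis
  have \<eta>: "0 < \<eta> x" and U: "open (U x)" "x \<in> U x" if "x \<in> A" for x
    using *[OF that] by (auto simp: desingularizing_def)
  have mono: "0 \<le> \<phi> x t \<and> \<phi> x t \<le> \<phi> x s" if "x \<in> A" "0 \<le> t" "t \<le> s" "s < \<eta> x" for x s t
    using *[OF that(1)] that by (simp add: desingularizing_def)
  have ineq: "s - t \<le> (\<phi> x s - \<phi> x t) * norm w"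
    if "x \<in> A" "y \<in> U x" "w \<in> limiting_subdiff f y" "f y = ereal (c + s)" "0 < s"
      "s < \<eta> x" "0 \<le> t" "t \<le> s" for x y w s t
    using *[OF that(1)] that by (simp add: desingularizing_def)
  have "A \<subseteq> (\<Union>x\<in>A. U x)" using U(2) by blast
  then obtain T where T: "T \<subseteq> A" "finite T" "A \<subseteq> (\<Union>x\<in>T. U x)"
    using compactE_image[OF \<open>compact A\<close>, of A U] U(1) by blast
  then have "T \<noteq> {}" using False by blast
  \<comment> \<open>The finitely many positive ranges \<open>\<eta> x\<close> share the positive
    range \<open>m\<close>.\<close>
  define m where "m = Min (\<eta> ` T)"
  have m: "0 < m" "\<And>x. x \<in> T \<Longrightarrow> m \<le> \<eta> x" using T \<open>T \<noteq> {}\<close> \<eta> by (auto simp: m_def)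
  let ?\<phi> = "\<lambda>t. \<Sum>x\<in>T. \<phi> x t"
  have "0 \<le> ?\<phi> t \<and> ?\<phi> t \<le> ?\<phi> s" if "0 \<le> t" "t \<le> s" "s < m" for s t
  proof -
    have "0 \<le> \<phi> x t \<and> \<phi> x t \<le> \<phi> x s" if "x \<in> T" for x
      using mono[of x t s] m(2)[OF that] T that \<open>0 \<le> t\<close> \<open>t \<le> s\<close> \<open>s < m\<close> by auto
    then show ?thesis by (simp add: sum_nonneg sum_mono)
  qed
  moreover have "s - t \<le> (?\<phi> s - ?\<phi> t) * norm w"
    if y: "y \<in> (\<Union>x\<in>T. U x)" "w \<in> limiting_subdiff f y" "f y = ereal (c + s)"
      and s: "0 < s" "s < m" "0 \<le> t" "t \<le> s" for y w s t
  proof -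
    obtain x where x: "x \<in> T" "y \<in> U x" using y by blast
    have le: "0 \<le> \<phi> x' s - \<phi> x' t" if "x' \<in> T" for x'
      using mono[of x' t s] T m(2)[OF that] that s by auto
    \<comment> \<open>All increments are nonnegative, so the one belonging to the patch containing
      \<open>y\<close> is dominated by the sum.\<close>
    have "\<phi> x s - \<phi> x t \<le> (\<Sum>x\<in>T. \<phi> x s - \<phi> x t)"
      using x T le by (intro member_le_sum) auto
    then have "(\<phi> x s - \<phi> x t) * norm w \<le> (?\<phi> s - ?\<phi> t) * norm w"
      by (intro mult_right_mono) (auto simp: sum_subtractf)
    moreover have "s - t \<le> (\<phi> x s - \<phi> x t) * norm w"
      using x T m(2)[OF x(1)] y s by (intro ineq[of x y]) auto
    ultimately show ?thesis by linarith
  qed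
  moreover have "open (\<Union>x\<in>T. U x)" using T U by blast
  ultimately have "desingularizing f c m ?\<phi> (\<Union>x\<in>T. U x)"
    using m(1) unfolding desingularizing_def by blast
  then show ?thesis using T(3) by blast
qed

section \<open>Finite length and convergence\<close>

lemma summable_of_KL_recursion:
  fixes d P :: "nat \<Rightarrow> real"
  assumes d: "\<And>k. 0 \<le> d k" and P: "\<And>k. 0 \<le> P k" and "0 \<le> c"
    and rec: "\<And>k. 2 * d (Suc k) \<le> d k + c * (P k - P (Suc k))"
  shows "summable d"
proof (rule summableI_nonneg_bounded[OF d])
  fix n
  \<comment> \<open>Adding the potential \<open>2 * d n + c * P n\<close> to the partial sum makes
    the bound inductive; both of its terms are nonnegative and are discarded afterwards.\<close>
  have "(\<Sum>k<n. d k) + 2 * d n + c * P n \<le> 2 * d 0 + c * P 0" for n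
  proof (induction n)
    case (Suc n)
    then show ?case using rec[of n] by (simp add: algebra_simps)
  qed simp
  from this[of n] show "(\<Sum>k<n. d k) \<le> 2 * d 0 + c * P 0"
    using d[of n] mult_nonneg_nonneg[OF \<open>0 \<le> c\<close> P[of n]] by linarith
qed

lemma convergent_of_summable_dist:
  fixes z :: "nat \<Rightarrow> 'a::banach"
  assumes "summable (\<lambda>k. norm (z (Suc k) - z k))"
  shows "convergent z"
proof -
  have "summable (\<lambda>k. z (Suc k) - z k)" using assms by (rule summable_norm_cancel)
  then have "convergent (\<lambda>n. \<Sum>k<n. z (Suc k) - z k)" by (simp add: summable_iff_convergent)
  then have "convergent (\<lambda>n. z n - z 0)" by (simp add: sum_lessThan_telescope)
  then have "convergent (\<lambda>n. z 0 + (z n - z 0))" by (intro convergent_add convergent_const)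
  then show ?thesis by simp
qed

text \<open>\<open>x v* A\<close> is the adjoint of \<open>A\<close> applied to \<open>x\<close>,
  the form in which Jacobians enter gradients. Bilinearity yields its continuity, limits and norm
  bound.\<close>

lemma bounded_bilinear_vector_matrix_mult:
  "bounded_bilinear (\<lambda>(x :: real^'m) (A :: real^'n^'m). x v* A)"
  by (subst bilinear_conv_bounded_bilinear[symmetric])
    (auto simp: bilinear_def vector_matrix_mult_def vec_eq_iff sum.distrib algebra_simps
      sum_distrib_left intro!: linearI)

subsection \<open>Accumulation points\<close>

text \<open>Replaces subsequences by visits to every ball at arbitrarily late indices. Conversely,
  indices are chosen recursively, each larger than the last and with shrinking radius.\<close>

lemma accum_iff:
  fixes u :: "nat \<Rightarrow> 'a::metric_space"
  shows "l \<in> accum u \<longleftrightarrow> (\<forall>e>0. \<forall>N. \<exists>n\<ge>N. dist (u n) l < e)"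
proof
  assume "l \<in> accum u"
  then obtain r :: "nat \<Rightarrow> nat" where r: "strict_mono r" "(u \<circ> r) \<longlonglongrightarrow> l"
    by (auto simp: accum_def)
  show "\<forall>e>0. \<forall>N. \<exists>n\<ge>N. dist (u n) l < e"
  proof (intro allI impI)
    fix e :: real and N :: nat assume "0 < e"
    then obtain M where M: "\<And>n. M \<le> n \<Longrightarrow> dist (u (r n)) l < e"
      using r(2) by (auto simp: lim_sequentially)
    have "N \<le> r (max N M)" using seq_suble[OF r(1), of "max N M"] by linarith
    then show "\<exists>n\<ge>N. dist (u n) l < e" using M[of "max N M"] by auto
  qed
next
  assume *: "\<forall>e>0. \<forall>N. \<exists>n\<ge>N. dist (u n) l < e"
  have "\<exists>r. \<forall>n. dist (u (r n)) l < inverse (real (Suc n)) \<and> r n < r (Suc n)"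
  proof (rule dependent_nat_choice)
    show "\<exists>x. dist (u x) l < inverse (real (Suc 0))"
      using *[rule_format, of "inverse (real (Suc 0))" 0] by auto
    show "\<exists>y. dist (u y) l < inverse (real (Suc (Suc n))) \<and> x < y" for x n
      using *[rule_format, of "inverse (real (Suc (Suc n)))" "Suc x"]
      by (auto simp: Suc_le_eq)
  qed
  then obtain r where r: "\<And>n. dist (u (r n)) l < inverse (real (Suc n))" "\<And>n. r n < r (Suc n)"
    by blast
  have "(u \<circ> r) \<longlonglongrightarrow> l"
    using LIMSEQ_dist_le_inverse_Suc[of "\<lambda>_. l" l "u \<circ> r"] r(1) by simp
  moreover have "strict_mono r" using r(2) by (simp add: strict_mono_Suc_iff)
  ultimately show "l \<in> accum u" by (auto simp: accum_def)
qed

lemma closed_accum: "closed (accum (u :: nat \<Rightarrow> 'a::metric_space))"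
  unfolding closure_subset_eq[symmetric]
proof
  fix x assume "x \<in> closure (accum u)"
  then have *: "\<forall>e>0. \<exists>y\<in>accum u. dist y x < e" by (simp add: closure_approachable)
  show "x \<in> accum u"
    unfolding accum_iff
  proof (intro allI impI)
    fix e :: real and N :: nat assume "0 < e"
    then obtain y where y: "y \<in> accum u" "dist y x < e / 2" using *[rule_format, of "e / 2"] by auto
    then obtain n where "N \<le> n" "dist (u n) y < e / 2"
      using \<open>0 < e\<close> unfolding accum_iff by (meson half_gt_zero)
    then show "\<exists>n\<ge>N. dist (u n) x < e"
      using dist_triangle_half_r[of y "u n" e x] y(2) by (auto simp: dist_commute)
  qed
qed

lemma compact_accum:
  fixes u :: "nat \<Rightarrow> 'a::heine_borel"
  assumes "bounded (range u)"
  shows "compact (accum u)"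
proof -
  have "accum u \<subseteq> closure (range u)"
  proof
    fix x assume "x \<in> accum u"
    then show "x \<in> closure (range u)"
      unfolding accum_iff closure_approachable by (metis rangeI)
  qed
  then have "bounded (accum u)" using assms by (meson bounded_closure bounded_subset)
  then show ?thesis using closed_accum by (simp add: compact_eq_bounded_closed)
qed

text \<open>Otherwise a subsequence stays outside \<open>U\<close>; by boundedness it has a cluster
  point, which belongs to \<open>accum u\<close> and hence to the open set \<open>U\<close>, a
  contradiction.\<close>

lemma eventually_in_nhd_of_accum:
  fixes u :: "nat \<Rightarrow> 'a::heine_borel"
  assumes "bounded (range u)" "open U" "accum u \<subseteq> U"
  shows "eventually (\<lambda>n. u n \<in> U) sequentially"
proof (rule ccontr)
  assume "\<not> ?thesis"
  then obtain r :: "nat \<Rightarrow> nat" where r: "strict_mono r" "\<And>n. u (r n) \<notin> U"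
    using not_eventually_sequentiallyD by blast
  have "bounded (range (u \<circ> r))" using assms(1) by (rule bounded_subset) auto
  then obtain l s where s: "strict_mono (s :: nat \<Rightarrow> nat)" "((u \<circ> r) \<circ> s) \<longlonglongrightarrow> l"
    using bounded_imp_convergent_subsequence by blast
  have "l \<in> accum u"
    unfolding accum_def using s strict_mono_o[OF r(1) s(1)] by (auto simp: o_assoc)
  then have "eventually (\<lambda>n. ((u \<circ> r) \<circ> s) n \<in> U) sequentially"
    using assms topological_tendstoD[OF s(2)] by blast
  then show False using r(2) by (auto simp: eventually_sequentially)
qed

text \<open>Coercivity bounds the iterates only from index 1 on, where the objective is known to be
  finite.\<close>

lemma bounded_range_of_Suc:
  assumes "bounded (range (\<lambda>k. u (Suc k)))"
  shows "bounded (range u)"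
proof -
  have "range u = insert (u 0) (range (\<lambda>k. u (Suc k)))"
    by (metis (no_types) UNIV_nat_eq image_image image_insert)
  then show ?thesis using assms by simp
qed

subsection \<open>The Bregman iteration\<close>

locale bregman_iteration =
  fixes C :: "(real^'m) set"
    and h G :: "real^'m \<Rightarrow> ereal"
    and R :: "real^'n \<Rightarrow> ereal"
    and \<rho> :: "real^'n \<Rightarrow> real^'m"
    and L \<tau> :: real
    and u :: "nat \<Rightarrow> real^'n"
  assumes A: "assumptions_A C h G R \<rho> L \<tau> u"
    and B: "assumptions_B h G R \<rho> L \<tau> u"
begin

abbreviation "D \<equiv> interior (edom h)"
abbreviation "hr x \<equiv> real_of_ereal (h x)"
abbreviation "Gr x \<equiv> real_of_ereal (G x)"
abbreviation "E \<equiv> objective G R \<rho>"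
abbreviation "J v \<equiv> jacobian \<rho> (at v)"
abbreviation "z k \<equiv> \<rho> (u k)"
abbreviation "\<Psi> x \<equiv> (1 / \<tau>) *\<^sub>R egrad h x - egrad G x"

section \<open>Consequences of the assumptions\<close>

lemma basic: "basic_assumptions C h G R \<rho>"
  using A by (simp add: assumptions_A_def)

lemma proper_h: "proper_fun h" and convex_h: "convex_fun h" and smooth_h: "essentially_smooth h"
  and proper_G: "proper_fun G" and dom_h_G: "edom h \<subseteq> edom G" and proper_R: "proper_fun R"
  and differentiable_G: "Gr differentiable_on D" and cont_\<rho>: "continuous_on UNIV \<rho>"
  using basic by (simp_all add: basic_assumptions_def)

lemma constants: "0 < L" "0 < \<tau>" "L < 1 / \<tau>"
proof -
  show "0 < L" "0 < \<tau>" using A by (simp_all add: assumptions_A_def)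
  moreover have "\<tau> < 1 / L" using B by (simp add: assumptions_B_def)
  ultimately show "L < 1 / \<tau>" by (simp add: field_simps)
qed

lemma z_mem: "z k \<in> D"
  using A by (cases k) (simp_all add: assumptions_A_def)

lemma R_not_MInf: "R v \<noteq> -\<infinity>" using proper_R by (simp add: proper_fun_def)

lemma h_eq: "x \<in> D \<Longrightarrow> h x = ereal (hr x)"
  using proper_fun_ereal_real[OF proper_h] interior_subset by (metis subsetD)

lemma G_eq: "x \<in> D \<Longrightarrow> G x = ereal (Gr x)"
  using proper_fun_ereal_real[OF proper_G] interior_subset dom_h_G by (metis subsetD)

lemma E_eq: "\<rho> v \<in> D \<Longrightarrow> E v = R v + ereal (Gr (\<rho> v))"
  using G_eq[of "\<rho> v"] by (simp add: objective_def add.commute)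

lemma GDERIV_h: "x \<in> D \<Longrightarrow> GDERIV hr x :> egrad h x"
  and continuous_egrad_h: "continuous_on D (egrad h)"
  using essentially_smooth_GDERIV[OF proper_h convex_h smooth_h] by blast+

lemma GDERIV_G: "x \<in> D \<Longrightarrow> GDERIV Gr x :> egrad G x"
  using differentiable_G by (intro GDERIV_egrad) (simp add: differentiable_on_eq_differentiable_at)

lemma lipschitz_\<Psi>: "local_lipschitz (UNIV :: real set) D (\<lambda>_. \<Psi>)"
  using B by (simp add: assumptions_B_def)

text \<open>Differentiability of \<open>G\<close> alone does not make its gradient continuous. It is
  recovered as the difference of the continuous maps \<open>(1 / \<tau>) *\<^sub>R egrad h x\<close>
  and \<open>\<Psi> x\<close>.\<close>

lemma continuous_egrad_G: "continuous_on D (egrad G)"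
proof -
  have "continuous_on D \<Psi>"
    using local_lipschitz_continuous_on[OF lipschitz_\<Psi>] by auto
  moreover have "continuous_on D (\<lambda>x. (1 / \<tau>) *\<^sub>R egrad h x)"
    by (intro continuous_intros continuous_egrad_h)
  ultimately have "continuous_on D (\<lambda>x. (1 / \<tau>) *\<^sub>R egrad h x - \<Psi> x)"
    using continuous_on_diff by blast
  then show ?thesis by simp
qed

lemma open_preimage: "open (\<rho> -` D)"
  using cont_\<rho> by (simp add: open_vimage)

lemma GDERIV_compose_\<rho>:
  assumes "GDERIV g (\<rho> v) :> c"
  shows "GDERIV (\<lambda>v. g (\<rho> v)) v :> c v* J v"
proof -
  have "\<rho> differentiable at v"
    using B by (simp add: assumptions_B_def differentiable_on_eq_differentiable_at)
  then have "(\<rho> has_derivative (\<lambda>h. J v *v h)) (at v)" by (simp add: jacobian_works)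
  then have "((\<lambda>v. g (\<rho> v)) has_derivative (\<lambda>h. (J v *v h) \<bullet> c)) (at v)"
    using assms unfolding gderiv_def by (rule has_derivative_compose)
  moreover have "(J v *v h) \<bullet> c = h \<bullet> (c v* J v)" for h
    by (metis dot_lmul_matrix inner_commute)
  ultimately show ?thesis by (simp add: gderiv_def)
qed

lemma continuous_J: "continuous_on UNIV (\<lambda>v. J v)"
  using B by (simp add: assumptions_B_def)

lemma continuous_vector_matrix_J:
  assumes "continuous_on D f"
  shows "continuous_on (\<rho> -` D) (\<lambda>v. f (\<rho> v) v* J v)"
  using continuous_on_compose2[OF assms continuous_on_subset[OF cont_\<rho>]]
    continuous_on_subset[OF continuous_J]
  by (intro bounded_bilinear.continuous_on[OF bounded_bilinear_vector_matrix_mult]) auto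

section \<open>The surrogate and the optimality conditions\<close>

text \<open>The base point comes first, in contrast to \<open>bregman\<close>, so that
  \<open>breg y\<close> is a function of the moving point.\<close>

definition breg :: "real^'m \<Rightarrow> real^'m \<Rightarrow> real" where
  "breg y x = hr x - hr y - egrad h y \<bullet> (x - y)"

text \<open>The smooth part of the surrogate, seen as a real function of \<open>x\<close> in the
  outer space; the surrogate is \<open>R\<close> plus \<open>model\<close> composed with
  \<open>\<rho>\<close>.\<close>

definition model :: "real^'m \<Rightarrow> real^'m \<Rightarrow> real" where
  "model y x = 1 / \<tau> * breg y x + Gr y + egrad G y \<bullet> (x - y)"

lemma surrogate_eq:
  assumes "\<rho> w \<in> D" "\<rho> v \<in> D"
  shows "surrogate h G R \<rho> \<tau> w v = R v + ereal (model (\<rho> w) (\<rho> v))"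
  using assms h_eq[of "\<rho> w"] h_eq[of "\<rho> v"] G_eq[of "\<rho> w"] R_not_MInf[of v]
  by (cases "R v"; cases "h (\<rho> w)"; cases "h (\<rho> v)"; cases "G (\<rho> w)")
    (auto simp: surrogate_def bregman_def model_def breg_def)

lemma GDERIV_model:
  assumes "x \<in> D"
  shows "GDERIV (model y) x :> (1 / \<tau>) *\<^sub>R (egrad h x - egrad h y) + egrad G y"
proof -
  have "(hr has_derivative (\<lambda>v. v \<bullet> egrad h x)) (at x)"
    using GDERIV_h[OF assms] by (simp add: gderiv_def)
  then show ?thesis
    unfolding gderiv_def model_def breg_def
    using constants(2) by (auto intro!: derivative_eq_intros simp: algebra_simps inner_commute)
qed

text \<open>This is the condition that \<open>0\<close> is a limiting subgradient of the surrogate,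
  after subtracting the smooth model by the sum rule.\<close>

lemma subgradient_R:
  "- (((1 / \<tau>) *\<^sub>R (egrad h (z (Suc k)) - egrad h (z k)) + egrad G (z k)) v* J (u (Suc k)))
    \<in> limiting_subdiff R (u (Suc k))"
proof -
  let ?g = "\<lambda>x. (1 / \<tau>) *\<^sub>R (egrad h x - egrad h (z k)) + egrad G (z k)"
  have "0 + - (?g (\<rho> (u (Suc k))) v* J (u (Suc k))) \<in> limiting_subdiff R (u (Suc k))"
  proof (rule limiting_subdiff_add_smooth[where S = "\<rho> -` D"
        and f = "surrogate h G R \<rho> \<tau> (u k)" and s = "\<lambda>v. - model (z k) (\<rho> v)"
        and g = "\<lambda>v. - (?g (\<rho> v) v* J v)"])
    show "surrogate h G R \<rho> \<tau> (u k) v \<noteq> -\<infinity>" if "v \<in> \<rho> -` D" for v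
      using that surrogate_eq[OF z_mem] R_not_MInf[of v] by (cases "R v") auto
    show "R v = surrogate h G R \<rho> \<tau> (u k) v + ereal (- model (z k) (\<rho> v))" if "v \<in> \<rho> -` D" for v
      using that surrogate_eq[OF z_mem] R_not_MInf[of v] by (cases "R v") auto
    show "GDERIV (\<lambda>v. - model (z k) (\<rho> v)) v :> - (?g (\<rho> v) v* J v)" if "v \<in> \<rho> -` D" for v
      using that by (intro GDERIV_minus GDERIV_compose_\<rho> GDERIV_model) simp
    show "continuous_on (\<rho> -` D) (\<lambda>v. - (?g (\<rho> v) v* J v))"
      by (intro continuous_on_minus continuous_vector_matrix_J continuous_intros continuous_egrad_h)
    show "0 \<in> limiting_subdiff (surrogate h G R \<rho> \<tau> (u k)) (u (Suc k))"
      using B by (simp add: assumptions_B_def)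
  qed (use z_mem open_preimage in auto)
  then show ?thesis by simp
qed

text \<open>Adding the gradient of \<open>G\<close> composed with \<open>\<rho>\<close> at the new
  iterate to the subgradient of \<open>R\<close> leaves exactly a difference of values of
  \<open>\<Psi>\<close>.\<close>

lemma subgradient_E:
  "(\<Psi> (z k) - \<Psi> (z (Suc k))) v* J (u (Suc k)) \<in> limiting_subdiff E (u (Suc k))"
proof -
  let ?v = "u (Suc k)"
  let ?a = "(1 / \<tau>) *\<^sub>R (egrad h (z (Suc k)) - egrad h (z k)) + egrad G (z k)"
  interpret vm: bounded_bilinear "\<lambda>(x :: real^'m) (A :: real^'n^'m). x v* A"
    by (rule bounded_bilinear_vector_matrix_mult)
  have "- (?a v* J ?v) + egrad G (\<rho> ?v) v* J ?v \<in> limiting_subdiff E ?v"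
  proof (rule limiting_subdiff_add_smooth[where S = "\<rho> -` D" and f = R
        and s = "\<lambda>v. Gr (\<rho> v)" and g = "\<lambda>v. egrad G (\<rho> v) v* J v"])
    show "GDERIV (\<lambda>v. Gr (\<rho> v)) v :> egrad G (\<rho> v) v* J v" if "v \<in> \<rho> -` D" for v
      using that by (intro GDERIV_compose_\<rho> GDERIV_G) simp
    show "continuous_on (\<rho> -` D) (\<lambda>v. egrad G (\<rho> v) v* J v)"
      by (intro continuous_vector_matrix_J continuous_egrad_G)
  qed (use z_mem open_preimage subgradient_R E_eq R_not_MInf in auto)
  moreover have "- (?a v* J ?v) + egrad G (\<rho> ?v) v* J ?v = (\<Psi> (z k) - \<Psi> (z (Suc k))) v* J ?v"
    unfolding vm.minus_left[symmetric] vm.add_left[symmetric]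
    by (rule arg_cong[of _ _ "\<lambda>x. x v* J ?v"]) (simp add: algebra_simps)
  ultimately show ?thesis by simp
qed

text \<open>The values start at \<open>u 1\<close> because \<open>E (u 0) = \<infinity>\<close> is possible.\<close>

definition val :: "nat \<Rightarrow> real" where "val k = real_of_ereal (E (u (Suc k)))"

text \<open>Having a limiting subgradient at a point includes membership in the effective
  domain.\<close>

lemma R_Suc_finite: "R (u (Suc k)) = ereal (real_of_ereal (R (u (Suc k))))"
  using subgradient_R[of k] proper_fun_ereal_real[OF proper_R, of "u (Suc k)"]
  by (simp add: limiting_subdiff_def)

lemma val_eq: "val k = real_of_ereal (R (u (Suc k))) + Gr (z (Suc k))"
  unfolding val_def E_eq[OF z_mem] by (subst R_Suc_finite) simp

lemma E_Suc: "E (u (Suc k)) = ereal (val k)"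
  unfolding val_eq E_eq[OF z_mem] by (subst R_Suc_finite) simp

section \<open>Descent, boundedness and limiting values\<close>

lemma descent:
  obtains a where "0 < a" "\<And>k. val (Suc k) + a * (norm (z (Suc (Suc k)) - z (Suc k)))\<^sup>2 \<le> val k"
proof -
  obtain \<sigma> where \<sigma>: "0 < \<sigma>" "strongly_convex_on \<sigma> D hr"
    using B by (auto simp: assumptions_B_def)
  show thesis
  proof
    \<comment> \<open>\<open>1 / \<tau> - L\<close> is the share of the Bregman distance left over
      after majorizing \<open>G\<close>; \<open>\<sigma> / 2\<close> comes from the quadratic lower
      bound of that distance.\<close>
    show "0 < (1 / \<tau> - L) * (\<sigma> / 2)" using constants \<sigma> by simp
    fix k
    let ?y = "z (Suc k)" and ?x = "z (Suc (Suc k))"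
    have "surrogate h G R \<rho> \<tau> (u (Suc k)) (u (Suc (Suc k)))
        \<le> surrogate h G R \<rho> \<tau> (u (Suc k)) (u (Suc k))"
      using A by (simp add: assumptions_A_def)
    then have "real_of_ereal (R (u (Suc (Suc k)))) + model ?y ?x
        \<le> real_of_ereal (R (u (Suc k))) + model ?y ?y"
      unfolding surrogate_eq[OF z_mem z_mem] by (subst (asm) (1 2) R_Suc_finite) simp
    then have "real_of_ereal (R (u (Suc (Suc k)))) + 1 / \<tau> * breg ?y ?x + egrad G ?y \<bullet> (?x - ?y)
        \<le> real_of_ereal (R (u (Suc k)))"
      by (simp add: model_def breg_def)
    \<comment> \<open>The tangent inequality of the convex function \<open>L h - G\<close> at
      \<open>?y\<close>, rearranged.\<close>
    moreover have "Gr ?x \<le> Gr ?y + egrad G ?y \<bullet> (?x - ?y) + L * breg ?y ?x"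
    proof -
      have "strongly_convex_on 0 D (\<lambda>x. L * hr x - Gr x)"
        using A by (intro convex_on_imp_strongly_convex_on_0) (simp add: assumptions_A_def)
      moreover have "GDERIV (\<lambda>x. L * hr x - Gr x) ?y :> L *\<^sub>R egrad h ?y - egrad G ?y"
      proof -
        have "(hr has_derivative (\<lambda>v. v \<bullet> egrad h ?y)) (at ?y)"
            "(Gr has_derivative (\<lambda>v. v \<bullet> egrad G ?y)) (at ?y)"
          using GDERIV_h[OF z_mem] GDERIV_G[OF z_mem] by (simp_all add: gderiv_def)
        then show ?thesis
          unfolding gderiv_def
          by (auto intro!: derivative_eq_intros simp: algebra_simps)
      qed
      ultimately show ?thesis
        using strongly_convex_on_ge_tangent[OF _ z_mem z_mem]
        by (fastforce simp: breg_def algebra_simps)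
    qed
    moreover have "(1 / \<tau> - L) * (\<sigma> / 2 * (norm (?x - ?y))\<^sup>2) \<le> (1 / \<tau> - L) * breg ?y ?x"
      using strongly_convex_on_ge_tangent[OF \<sigma>(2) z_mem z_mem GDERIV_h[OF z_mem]] constants
      by (intro mult_left_mono) (auto simp: breg_def algebra_simps)
    ultimately show "val (Suc k) + (1 / \<tau> - L) * (\<sigma> / 2) * (norm (?x - ?y))\<^sup>2 \<le> val k"
      unfolding val_eq left_diff_distrib by (simp add: mult.assoc)
  qed
qed

lemma decseq_val: "decseq val"
proof -
  obtain a where "0 < a" and a: "\<And>k. val (Suc k) + a * (norm (z (Suc (Suc k)) - z (Suc k)))\<^sup>2 \<le> val k"
    using descent by blast
  show ?thesis
  proof (rule decseq_SucI)
    fix k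
    have "0 \<le> a * (norm (z (Suc (Suc k)) - z (Suc k)))\<^sup>2" using \<open>0 < a\<close> by simp
    then show "val (Suc k) \<le> val k" using a[of k] by linarith
  qed
qed

lemma val_convergent:
  obtains c where "val \<longlonglongrightarrow> c" "\<And>k. c \<le> val k"
proof -
  obtain b :: real where "\<And>v. ereal b \<le> E v" using A by (auto simp: assumptions_A_def)
  then have "b \<le> val k" for k using E_Suc[of k] by (metis ereal_less_eq(3))
  then show thesis using decseq_convergent[OF decseq_val] that by blast
qed

text \<open>The iterates from index 1 on lie in a sublevel set of \<open>E\<close>, which is bounded
  by coercivity.\<close>

lemma bounded_u: "bounded (range u)"
proof (rule bounded_range_of_Suc)
  have "(E \<longlongrightarrow> \<infinity>) at_infinity" using A by (simp add: assumptions_A_def)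
  then have "eventually (\<lambda>v. ereal (val 0) < E v) at_infinity" by (rule order_tendstoD) simp
  then obtain b where b: "\<And>v. b \<le> norm v \<Longrightarrow> ereal (val 0) < E v"
    by (auto simp: eventually_at_infinity)
  have "norm (u (Suc k)) \<le> b" for k
  proof (rule ccontr)
    assume "\<not> ?thesis"
    then have "ereal (val 0) < E (u (Suc k))" by (intro b) simp
    then show False using decseqD[OF decseq_val, of 0 k] by (simp add: E_Suc)
  qed
  then show "bounded (range (\<lambda>k. u (Suc k)))" by (auto intro!: boundedI)
qed

text \<open>\<open>KL_at\<close> places \<open>v\<close> in the domain of \<open>E\<close>, on which
  \<open>E\<close> is continuous, so \<open>E v\<close> is the limit of the values along the
  subsequence.\<close>

lemma E_accum:
  assumes "val \<longlonglongrightarrow> c" "v \<in> accum u"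
  shows "E v = ereal c"
proof -
  obtain r :: "nat \<Rightarrow> nat" where r: "strict_mono r" "(u \<circ> r) \<longlonglongrightarrow> v"
    using assms(2) by (auto simp: accum_def)
  have "(\<lambda>k. E (u (Suc k))) \<longlonglongrightarrow> ereal c" using assms(1) by (simp add: E_Suc)
  then have "(\<lambda>k. E (u k)) \<longlonglongrightarrow> ereal c" by (rule LIMSEQ_imp_Suc)
  from LIMSEQ_subseq_LIMSEQ[OF this r(1)]
  have lim: "(\<lambda>n. E ((u \<circ> r) n)) \<longlonglongrightarrow> ereal c" by (simp add: o_def)
  have "KL_at E v" using B assms(2) by (simp add: assumptions_B_def)
  then have v: "v \<in> edom E" by (simp add: KL_at_def)
  \<comment> \<open>Index \<open>0\<close> must be avoided since \<open>E (u 0)\<close> may be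
    infinite; \<open>r n \<ge> n\<close> excludes it for positive \<open>n\<close>.\<close>
  have "eventually (\<lambda>n. (u \<circ> r) n \<in> edom E) sequentially"
    using eventually_gt_at_top[of 0]
  proof eventually_elim
    case (elim n)
    then have "r n \<noteq> 0" using seq_suble[OF r(1), of n] by simp
    then obtain k where "r n = Suc k" using not0_implies_Suc by blast
    then show ?case by (simp add: edom_def E_Suc)
  qed
  moreover have "continuous_on (edom E) E" using B by (simp add: assumptions_B_def)
  ultimately have "(\<lambda>n. E ((u \<circ> r) n)) \<longlonglongrightarrow> E v"
    using continuous_on_tendsto_compose r(2) v by blast
  then show ?thesis using lim LIMSEQ_unique by blast
qed

lemma closure_z: "closure (range (\<lambda>k. z (Suc k))) \<subseteq> D"
proof -
  have "range (\<lambda>k. z (Suc k)) = {\<rho> (u k) | k. 1 \<le> k}"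
    by (auto simp: image_iff) (metis Suc_le_D)
  then show ?thesis using B by (simp add: assumptions_B_def)
qed

section \<open>Subgradient bound and finite length of the outer sequence\<close>

text \<open>The closure of the outer iterates from index 1 on is compact and lies in
  \<open>D\<close>, so local Lipschitz continuity of \<open>\<Psi>\<close> becomes a uniform
  constant there. The Jacobian is bounded on the compact closure of the inner iterates.\<close>

lemma subgradient_bound:
  obtains M where "0 < M" "\<And>k. norm ((\<Psi> (z (Suc k)) - \<Psi> (z (Suc (Suc k)))) v* J (u (Suc (Suc k))))
    \<le> M * norm (z (Suc (Suc k)) - z (Suc k))"
proof -
  interpret vm: bounded_bilinear "\<lambda>(x :: real^'m) (A :: real^'n^'m). x v* A"
    by (rule bounded_bilinear_vector_matrix_mult)
  let ?K = "closure (range (\<lambda>k. z (Suc k)))"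
  have cU: "compact (closure (range u))" using bounded_u by simp
  have "compact (\<rho> ` closure (range u))"
    by (rule compact_continuous_image[OF continuous_on_subset[OF cont_\<rho> subset_UNIV] cU])
  moreover have "range (\<lambda>k. z (Suc k)) \<subseteq> \<rho> ` closure (range u)"
    using closure_subset by fastforce
  ultimately have "compact ?K"
    by (meson bounded_subset compact_closure compact_imp_bounded)
  moreover have "local_lipschitz {0::real} ?K (\<lambda>_. \<Psi>)"
    by (rule local_lipschitz_subset[OF lipschitz_\<Psi> subset_UNIV closure_z])
  ultimately obtain l where l: "l-lipschitz_on ?K \<Psi>"
    using local_lipschitz_compact_implies_lipschitz[where X = ?K and T = "{0::real}" and f = "\<lambda>_. \<Psi>"]
    by (auto simp: continuous_on_const)
  have "bounded ((\<lambda>v. J v) ` closure (range u))"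
    by (rule compact_imp_bounded[OF compact_continuous_image[OF
          continuous_on_subset[OF continuous_J subset_UNIV] cU]])
  then obtain j where "0 < j" and j: "\<And>v. v \<in> closure (range u) \<Longrightarrow> norm (J v) \<le> j"
    by (auto simp: bounded_pos)
  obtain b where "0 < b" and b: "\<And>(x :: real^'m) (A :: real^'n^'m). norm (x v* A) \<le> norm x * norm A * b"
    using vm.pos_bounded by blast
  have "0 \<le> l" using l by (rule lipschitz_on_nonneg)
  show thesis
  proof
    \<comment> \<open>The Lipschitz constant \<open>l\<close> may be \<open>0\<close>;
      \<open>l + 1\<close> keeps the bound positive.\<close>
    show "0 < (l + 1) * j * b" using \<open>0 \<le> l\<close> \<open>0 < j\<close> \<open>0 < b\<close> by simp
    fix k
    let ?x = "z (Suc (Suc k))" and ?y = "z (Suc k)" and ?v = "u (Suc (Suc k))"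
    have in_K: "?x \<in> ?K" "?y \<in> ?K" using closure_subset by fastforce+
    have "norm (\<Psi> ?y - \<Psi> ?x) \<le> l * norm (?y - ?x)"
      using lipschitz_onD[OF l in_K(2,1)] by (simp only: dist_norm)
    also have "\<dots> \<le> (l + 1) * norm (?x - ?y)"
      by (simp add: norm_minus_commute mult_right_mono)
    finally have 1: "norm (\<Psi> ?y - \<Psi> ?x) \<le> (l + 1) * norm (?x - ?y)" .
    have "?v \<in> closure (range u)" using closure_subset by fastforce
    then have "norm (\<Psi> ?y - \<Psi> ?x) * norm (J ?v) \<le> (l + 1) * norm (?x - ?y) * j"
      using 1 j \<open>0 \<le> l\<close> by (intro mult_mono) auto
    then have "norm (\<Psi> ?y - \<Psi> ?x) * norm (J ?v) * b \<le> (l + 1) * norm (?x - ?y) * j * b"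
      using \<open>0 < b\<close> by (intro mult_right_mono) auto
    then show "norm ((\<Psi> ?y - \<Psi> ?x) v* J ?v) \<le> (l + 1) * j * b * norm (?x - ?y)"
      using b[of "\<Psi> ?y - \<Psi> ?x" "J ?v"] by (simp only: mult_ac)
  qed
qed

lemma convergent_z: "convergent z"
proof -
  obtain c where c: "val \<longlonglongrightarrow> c" "\<And>k. c \<le> val k" using val_convergent by blast
  obtain a where "0 < a"
    and descent: "\<And>k. val (Suc k) + a * (norm (z (Suc (Suc k)) - z (Suc k)))\<^sup>2 \<le> val k"
    using descent by blast
  obtain M where "0 < M" and M: "\<And>k. norm ((\<Psi> (z (Suc k)) - \<Psi> (z (Suc (Suc k)))) v* J (u (Suc (Suc k))))
    \<le> M * norm (z (Suc (Suc k)) - z (Suc k))"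
    using subgradient_bound by blast
  have "KL_at E v" if "v \<in> accum u" for v using B that by (simp add: assumptions_B_def)
  then obtain \<eta> \<phi> U where des: "desingularizing E c \<eta> \<phi> U" and "accum u \<subseteq> U"
    using KL_uniformized[OF compact_accum[OF bounded_u], of E c] E_accum[OF c(1)] by blast
  then have "0 < \<eta>" "open U"
    and \<phi>: "\<And>s t. \<lbrakk>0 \<le> t; t \<le> s; s < \<eta>\<rbrakk> \<Longrightarrow> 0 \<le> \<phi> t \<and> \<phi> t \<le> \<phi> s"
    and KL: "\<And>y w s t. \<lbrakk>y \<in> U; w \<in> limiting_subdiff E y; E y = ereal (c + s); 0 < s; s < \<eta>;
      0 \<le> t; t \<le> s\<rbrakk> \<Longrightarrow> s - t \<le> (\<phi> s - \<phi> t) * norm w"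
    unfolding desingularizing_def by blast+
  have "eventually (\<lambda>k. u k \<in> U) sequentially"
    using eventually_in_nhd_of_accum[OF bounded_u \<open>open U\<close> \<open>accum u \<subseteq> U\<close>] .
  moreover have "eventually (\<lambda>k. val k < c + \<eta>) sequentially"
    using order_tendstoD(2)[OF c(1)] \<open>0 < \<eta>\<close> by simp
  ultimately obtain N where N: "\<And>k. N \<le> k \<Longrightarrow> u k \<in> U \<and> val k < c + \<eta>"
    using eventually_conj unfolding eventually_sequentially by (metis (no_types, lifting) linear order_trans)
  \<comment> \<open>From \<open>N\<close> on the iterates lie in \<open>U\<close> and the values
    within \<open>\<eta>\<close> of \<open>c\<close>; the extra successors account for the estimates
    starting at \<open>u 1\<close>.\<close>
  define d where "d k = norm (z (Suc (Suc (k + N))) - z (Suc (k + N)))" for k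
  define P where "P k = \<phi> (val (Suc (k + N)) - c)" for k
  have "summable d"
  proof (rule summable_of_KL_recursion[where P = P and c = "M / a"])
    show "0 \<le> d k" for k by (simp add: d_def)
    show "0 \<le> P k" for k
      using \<phi>[of _ "val (Suc (k + N)) - c"] c(2)[of "Suc (k + N)"] N[of "Suc (k + N)"]
      by (simp add: P_def)
    show "0 \<le> M / a" using \<open>0 < M\<close> \<open>0 < a\<close> by simp
    show "2 * d (Suc k) \<le> d k + M / a * (P k - P (Suc k))" for k
    proof -
      let ?k = "Suc (k + N)"
      let ?s = "val ?k - c" and ?t = "val (Suc ?k) - c"
      \<comment> \<open>A subgradient at \<open>u (Suc ?k)\<close>, whose value is
        \<open>val ?k\<close>. Its norm is controlled by the step \<open>d k\<close> leading there,
        whereas descent controls the following step \<open>d (Suc k)\<close>.\<close>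
      let ?w = "(\<Psi> (z ?k) - \<Psi> (z (Suc ?k))) v* J (u (Suc ?k))"
      have st: "0 \<le> ?t" "?t \<le> ?s" "?s < \<eta>"
        using c(2) decseqD[OF decseq_val, of ?k "Suc ?k"] N[of ?k] by simp_all
      have mono: "0 \<le> P k - P (Suc k)"
        using \<phi>[OF st] by (simp add: P_def)
      have step: "a * (d (Suc k))\<^sup>2 \<le> ?s - ?t" using descent[of ?k] by (simp add: d_def)
      have "?s - ?t \<le> (P k - P (Suc k)) * (M * d k)"
      \<comment> \<open>The KL inequality is available only strictly above the level
        \<open>c\<close>. At \<open>?s = 0\<close> the limit value is already attained, so
        \<open>?s - ?t\<close> cannot be positive.\<close>
      proof (cases "0 < ?s")
        case True
        have "u (Suc ?k) \<in> U" using N by simp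
        moreover have "E (u (Suc ?k)) = ereal (c + ?s)" by (simp add: E_Suc)
        ultimately have "?s - ?t \<le> (\<phi> ?s - \<phi> ?t) * norm ?w"
          using KL subgradient_E True st by blast
        also have "\<dots> = (P k - P (Suc k)) * norm ?w" by (simp add: P_def)
        also have "\<dots> \<le> (P k - P (Suc k)) * (M * d k)"
          using mono M[of "k + N"] by (intro mult_left_mono) (simp_all add: d_def)
        finally show ?thesis .
      next
        case False
        then have "?s - ?t \<le> 0" using st by linarith
        also have "0 \<le> (P k - P (Suc k)) * (M * d k)"
          using mono \<open>0 < M\<close> by (intro mult_nonneg_nonneg) (simp_all add: d_def)
        finally show ?thesis .
      qed
      then have "(d (Suc k))\<^sup>2 \<le> d k * (M / a * (P k - P (Suc k)))" (is "_ \<le> d k * ?q")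
        using step \<open>0 < a\<close> by (simp add: field_simps)
      \<comment> \<open>The arithmetic-geometric mean inequality linearizes the product
        \<open>d k * ?q\<close> and yields the recursion after taking square roots.\<close>
      moreover have "4 * (x * q) \<le> (x + q)\<^sup>2" for x q :: real
        using zero_le_power2[of "x - q"] by (simp add: power2_eq_square algebra_simps)
      note this[of "d k" ?q]
      moreover have "(2 * d (Suc k))\<^sup>2 = 4 * (d (Suc k))\<^sup>2" by (simp add: power_mult_distrib)
      ultimately have "(2 * d (Suc k))\<^sup>2 \<le> (d k + ?q)\<^sup>2" by linarith
      moreover have "0 \<le> d k + ?q"
        using mono \<open>0 < M\<close> \<open>0 < a\<close>
        by (intro add_nonneg_nonneg mult_nonneg_nonneg divide_nonneg_nonneg) (simp_all add: d_def)
      ultimately show ?thesis by (rule power2_le_imp_le)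
    qed
  qed
  then have "convergent (\<lambda>k. z (Suc (k + N)))"
    by (intro convergent_of_summable_dist) (simp add: d_def[abs_def])
  then show ?thesis
    using convergent_ignore_initial_segment[of z "Suc N"] by simp
qed

section \<open>Stationarity of the accumulation points\<close>

lemma accum_crit:
  assumes zs: "z \<longlonglongrightarrow> zs" and v: "v \<in> accum u"
  shows "v \<in> crit h G R \<rho> \<and> zs = \<rho> v"
proof -
  interpret vm: bounded_bilinear "\<lambda>(x :: real^'m) (A :: real^'n^'m). x v* A"
    by (rule bounded_bilinear_vector_matrix_mult)
  obtain r :: "nat \<Rightarrow> nat" where r: "strict_mono r" "(u \<circ> r) \<longlonglongrightarrow> v"
    using v by (auto simp: accum_def)
  \<comment> \<open>Arranged so that \<open>u (r (Suc n))\<close> is the outcome of the iteration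
    step \<open>m n\<close>; passing to \<open>Suc n\<close> guarantees
    \<open>r (Suc n) \<ge> 1\<close>, so the subtraction is exact.\<close>
  define m where "m n = r (Suc n) - 1" for n
  have Suc_m: "Suc (m n) = r (Suc n)" for n
    using seq_suble[OF r(1), of "Suc n"] by (simp add: m_def)
  have "r (Suc n) < r (Suc (Suc n))" for n using r(1) by (simp add: strict_mono_less)
  then have "strict_mono m" using Suc_m by (metis Suc_less_eq strict_mono_Suc_iff)
  have um: "(\<lambda>n. u (Suc (m n))) \<longlonglongrightarrow> v"
    using LIMSEQ_Suc[OF r(2)] by (simp add: Suc_m)
  have zm: "(\<lambda>n. z (m n)) \<longlonglongrightarrow> zs"
    using LIMSEQ_subseq_LIMSEQ[OF zs \<open>strict_mono m\<close>] by (simp add: o_def)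
  have zSm: "(\<lambda>n. z (Suc (m n))) \<longlonglongrightarrow> zs"
    using LIMSEQ_subseq_LIMSEQ[OF LIMSEQ_Suc[OF zs] \<open>strict_mono m\<close>] by (simp add: o_def)
  have "isCont \<rho> v" using cont_\<rho> by (simp add: continuous_on_eq_continuous_at)
  then have "(\<lambda>n. z (Suc (m n))) \<longlonglongrightarrow> \<rho> v" using um by (rule isCont_tendsto_compose)
  then have eq: "zs = \<rho> v" using zSm LIMSEQ_unique by blast
  have "zs \<in> closure (range (\<lambda>k. z (Suc k)))"
    unfolding closure_sequential using zSm by (intro exI[of _ "\<lambda>n. z (Suc (m n))"]) auto
  then have zD: "zs \<in> D" using closure_z by blast
  obtain c where c: "val \<longlonglongrightarrow> c" using val_convergent by blast
  have Ev: "E v = ereal c" using E_accum c v by blast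
  then have Rv: "R v = ereal (c - Gr zs)"
    using E_eq[of v] zD eq by (cases "R v") auto
  let ?g = "\<lambda>n. (1 / \<tau>) *\<^sub>R (egrad h (z (Suc (m n))) - egrad h (z (m n))) + egrad G (z (m n))"
  have tend: "(\<lambda>n. f (y n)) \<longlonglongrightarrow> f zs"
    if "continuous_on D f" "y \<longlonglongrightarrow> zs" "\<And>n. y n \<in> D" for f :: "real^'m \<Rightarrow> 'x::topological_space" and y
    using continuous_on_tendsto_compose[OF that(1,2) zD] that(3) by simp
  have "- (egrad G zs v* J v) \<in> limiting_subdiff R v"
  proof (rule limiting_subdiff_closed[OF R_not_MInf _ um])
    show "v \<in> edom R" by (simp add: edom_def Rv)
    \<comment> \<open>Closedness of the limiting subdifferential also requires convergence of the
      values of \<open>R\<close>, obtained as the objective values minus those of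
      \<open>G\<close>.\<close>
    have "continuous_on D Gr"
      using differentiable_G by (rule differentiable_imp_continuous_on)
    then have "(\<lambda>n. Gr (z (Suc (m n)))) \<longlonglongrightarrow> Gr zs" using zSm z_mem by (rule tend)
    moreover have "(\<lambda>n. val (m n)) \<longlonglongrightarrow> c"
      using LIMSEQ_subseq_LIMSEQ[OF c \<open>strict_mono m\<close>] by (simp add: o_def)
    ultimately have "(\<lambda>n. ereal (val (m n) - Gr (z (Suc (m n))))) \<longlonglongrightarrow> ereal (c - Gr zs)"
      by (intro tendsto_ereal tendsto_diff)
    moreover have "R (u (Suc (m n))) = ereal (val (m n) - Gr (z (Suc (m n))))" for n
      by (subst R_Suc_finite) (simp add: val_eq)
    ultimately show "(\<lambda>n. R (u (Suc (m n)))) \<longlonglongrightarrow> R v" by (simp add: Rv)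
    show "- (?g n v* J (u (Suc (m n)))) \<in> limiting_subdiff R (u (Suc (m n)))" for n
      by (rule subgradient_R)
    \<comment> \<open>Both \<open>z (m n)\<close> and \<open>z (Suc (m n))\<close> tend to
      \<open>zs\<close>, so the two gradients of \<open>h\<close> cancel in the limit. This uses
      convergence of the whole outer sequence.\<close>
    have "?g \<longlonglongrightarrow> (1 / \<tau>) *\<^sub>R (egrad h zs - egrad h zs) + egrad G zs"
      using tend[OF continuous_egrad_h zm z_mem] tend[OF continuous_egrad_h zSm z_mem]
        tend[OF continuous_egrad_G zm z_mem]
      by (intro tendsto_add tendsto_scaleR tendsto_diff tendsto_const)
    then have "?g \<longlonglongrightarrow> egrad G zs" by simp
    moreover have "(\<lambda>n. J (u (Suc (m n)))) \<longlonglongrightarrow> J v"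
      using continuous_J um by (intro continuous_on_tendsto_compose[OF continuous_J]) auto
    ultimately show "(\<lambda>n. - (?g n v* J (u (Suc (m n))))) \<longlonglongrightarrow> - (egrad G zs v* J v)"
      by (intro tendsto_minus vm.tendsto)
  qed
  then show ?thesis using zD eq by (simp add: crit_def)
qed

end

theorem corollary2:
  fixes C :: "(real^'m) set"
    and h G :: "real^'m \<Rightarrow> ereal"
    and R :: "real^'n \<Rightarrow> ereal"
    and \<rho> :: "real^'n \<Rightarrow> real^'m"
    and L \<tau> :: real
    and u :: "nat \<Rightarrow> real^'n"
  assumes "assumptions_A C h G R \<rho> L \<tau> u"
    and "assumptions_B h G R \<rho> L \<tau> u"
  shows "\<exists>zstar. (\<lambda>k. \<rho> (u k)) \<longlonglongrightarrow> zstar \<and>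
           (\<forall>ustar \<in> accum u. ustar \<in> crit h G R \<rho> \<and> zstar = \<rho> ustar)"
proof -
  interpret bregman_iteration C h G R \<rho> L \<tau> u
    by unfold_locales (fact assms)+
  obtain zs where "z \<longlonglongrightarrow> zs" using convergent_z by (auto simp: convergent_def)
  then show ?thesis using accum_crit by blast
qed

end
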